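(* For every fixed integer $k\ge 4$, there are infinitely many $k$-critical graphs in which every cycle has at most a constant number of chords, the constant depending only on $k$. More precisely, for every $k\ge4$ and every $m\ge 1$, the graph $H_{k,m}$ (defined in the context) is $k$-critical, has $(25k-80)m+26k-73$ vertices, and each of its cycles has at most $$\binom{k-3}{2}+10(k-3)^2+60(k-3)$$ chords.
   Context: All graphs are finite and simple. A graph $G$ is $k$-critical if $\chi(G)=k$ and every proper subgraph of $G$ is $(k-1)$-colorable. A chord of a cycle $C$ in $G$ is an edge of $G$ joining two vertices of $C$ that are not consecutive on $C$. Construction of $H_{k,m}$. Let $k\ge4$, $m\ge1$ and $p=k-3$. Let $Q=\{q_1,\ldots,q_p\}$ be a clique. For each $i\in\{0,\ldots,m\}$ take a pentagon ($5$-cycle) $S_i=a_ib_ic_id_it_ia_i$ (all these vertices being distinct and disjoint from $Q$), and add the edges $c_ia_{i+1}$ for $0\le i<m$. For a vertex $x$ of some $S_i$ and $j\in\{1,\ldots,p\}$, "attaching the leaf $L_j(x)$" means: add five new vertices $r,u,v,w,z$ forming a pentagon $ruvwzr$, add the edge $xr$, add all edges from each of $u,v,w,z$ to all vertices of $Q$, and add all edges from $r$ to $Q\setminus\{q_j\}$ (no other edges involve these new vertices). Attach the following leaves, each with its own new vertices: for every $0\le i\le m$ and every $1\le j\le p$, the leaves $L_j(b_i),L_j(d_i),L_j(t_i)$; for every $1\le j\le p$, the leaves $L_j(a_0)$ and $L_j(c_m)$; for $1\le i\le m$ and $2\le j\le p$, the leaf $L_j(a_i)$; for $0\le i<m$ and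 $2\le j\le p$, the leaf $L_j(c_i)$. The resulting graph is $H_{k,m}$. *)

theory Defs
  imports Main
begin

record 'a sgraph =
  verts :: "'a set"
  edges :: "'a set set"

definition simple_graph :: "'a sgraph \<Rightarrow> bool" where
  "simple_graph G \<longleftrightarrow> finite (verts G) \<and>
     (\<forall>e\<in>edges G. e \<subseteq> verts G \<and> card e = 2)"

definition subgraph :: "'a sgraph \<Rightarrow> 'a sgraph \<Rightarrow> bool" where
  "subgraph H G \<longleftrightarrow> simple_graph H \<and> verts H \<subseteq> verts G \<and> edges H \<subseteq> edges G"

definition proper_subgraph :: "'a sgraph \<Rightarrow> 'a sgraph \<Rightarrow> bool" where
  "proper_subgraph H G \<longleftrightarrow> subgraph H G \<and> H \<noteq> G"

definition isomorphic :: "'a sgraph \<Rightarrow> 'b sgraph \<Rightarrow> bool" where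
  "isomorphic G H \<longleftrightarrow> (\<exists>f. bij_betw f (verts G) (verts H) \<and>
     (\<forall>x\<in>verts G. \<forall>y\<in>verts G. {x, y} \<in> edges G \<longleftrightarrow> {f x, f y} \<in> edges H))"

definition colorable :: "nat \<Rightarrow> 'a sgraph \<Rightarrow> bool" where
  "colorable n G \<longleftrightarrow> (\<exists>f :: 'a \<Rightarrow> nat. (\<forall>x\<in>verts G. f x < n) \<and>
     (\<forall>x y. {x, y} \<in> edges G \<longrightarrow> f x \<noteq> f y))"

definition chromatic_number :: "'a sgraph \<Rightarrow> nat" where
  "chromatic_number G = (LEAST n. colorable n G)"

definition critical :: "nat \<Rightarrow> 'a sgraph \<Rightarrow> bool" where
  "critical k G \<longleftrightarrow> chromatic_number G = k \<and>
     (\<forall>H. proper_subgraph H G \<longrightarrow> colorable (k - 1) H)"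

text \<open>A cycle is given by the list of its vertices in cyclic order, the first one not repeated
  at the end. Each cycle is represented by several lists, all with the same chords.\<close>

definition cycle_edges :: "'a list \<Rightarrow> 'a set set" where
  "cycle_edges c = {{c ! i, c ! (Suc i mod length c)} | i. i < length c}"

definition is_cycle :: "'a sgraph \<Rightarrow> 'a list \<Rightarrow> bool" where
  "is_cycle G c \<longleftrightarrow> 3 \<le> length c \<and> distinct c \<and> cycle_edges c \<subseteq> edges G"

definition chords :: "'a sgraph \<Rightarrow> 'a list \<Rightarrow> 'a set set" where
  "chords G c = {{x, y} | x y. {x, y} \<in> edges G \<and> x \<in> set c \<and> y \<in> set c \<and>
                              {x, y} \<notin> cycle_edges c}"

datatype corner = CA | CB | CC | CD | CT

datatype leaf_vert = LR | LU | LV | LW | LZ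

text \<open>\<open>Clq j\<close> is $q_j$; \<open>Pent x i\<close> is the vertex $x_i$ of the pentagon $S_i$; \<open>Leaf x i j l\<close> is the vertex
  \<open>l\<close> of the leaf $L_j(x_i)$.\<close>

datatype hvert = Clq nat | Pent corner nat | Leaf corner nat nat leaf_vert

text \<open>\<open>(x, i, j) \<in> leaves p m\<close> means that the leaf $L_j(x_i)$ is attached.\<close>

definition leaves :: "nat \<Rightarrow> nat \<Rightarrow> (corner \<times> nat \<times> nat) set" where
  "leaves p m =
     {(x, i, j) | x i j. x \<in> {CB, CD, CT} \<and> i \<in> {0..m} \<and> j \<in> {1..p}} \<union>
     {(CA, 0, j) | j. j \<in> {1..p}} \<union>
     {(CC, m, j) | j. j \<in> {1..p}} \<union>
     {(CA, i, j) | i j. i \<in> {1..m} \<and> j \<in> {2..p}} \<union>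
     {(CC, i, j) | i j. i \<in> {0..<m} \<and> j \<in> {2..p}}"

definition pentagon :: "'a \<Rightarrow> 'a \<Rightarrow> 'a \<Rightarrow> 'a \<Rightarrow> 'a \<Rightarrow> 'a set set" where
  "pentagon x1 x2 x3 x4 x5 = {{x1, x2}, {x2, x3}, {x3, x4}, {x4, x5}, {x5, x1}}"

definition leaf_edges :: "nat \<Rightarrow> corner \<Rightarrow> nat \<Rightarrow> nat \<Rightarrow> hvert set set" where
  "leaf_edges p x i j =
     pentagon (Leaf x i j LR) (Leaf x i j LU) (Leaf x i j LV) (Leaf x i j LW) (Leaf x i j LZ) \<union>
     {{Pent x i, Leaf x i j LR}} \<union>
     {{Leaf x i j l, Clq h} | l h. l \<in> {LU, LV, LW, LZ} \<and> h \<in> {1..p}} \<union>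
     {{Leaf x i j LR, Clq h} | h. h \<in> {1..p} - {j}}"

definition H_graph :: "nat \<Rightarrow> nat \<Rightarrow> hvert sgraph" where
  "H_graph k m = (let p = k - 3 in
     \<lparr> verts =
         {Clq j | j. j \<in> {1..p}} \<union>
         {Pent x i | x i. i \<in> {0..m}} \<union>
         {Leaf x i j l | x i j l. (x, i, j) \<in> leaves p m},
       edges =
         {{Clq h, Clq j} | h j. h \<in> {1..p} \<and> j \<in> {1..p} \<and> h \<noteq> j} \<union>
         (\<Union>i\<in>{0..m}. pentagon (Pent CA i) (Pent CB i) (Pent CC i) (Pent CD i) (Pent CT i)) \<union>
         {{Pent CC i, Pent CA (i + 1)} | i. i \<in> {0..<m}} \<union>
         (\<Union>(x, i, j)\<in>leaves p m. leaf_edges p x i j) \<rparr>)"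

end

theory Submission
  imports Defs "HOL-Library.Countable"
begin

text \<open>In a coloring with \<open>k - 1\<close> colors the clique leaves two colors \<open>\<alpha>\<close>, \<open>\<beta>\<close> for the four other
  vertices of each leaf pentagon, so the root of the leaf \<open>L\<^sub>j(x)\<close> has the color of \<open>q\<^sub>j\<close> and \<open>x\<close>
  does not. Hence all \<open>b\<^sub>i, d\<^sub>i, t\<^sub>i, a\<^sub>0, c\<^sub>m\<close> are colored by \<open>\<alpha>\<close>, \<open>\<beta>\<close>, and \<open>a\<^sub>i\<close> and \<open>c\<^sub>i\<close> by
  \<open>\<alpha>\<close>, \<open>\<beta>\<close> or the color of \<open>q\<^sub>1\<close>. As a pentagon is an odd cycle, \<open>c\<^sub>0\<close> must have the color of
  \<open>q\<^sub>1\<close>, thus \<open>a\<^sub>1\<close> does not, and so on up to \<open>c\<^sub>m\<close>, a contradiction. Deleting an edge that belongs to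
  level \<open>i\<close> repairs this: the color of \<open>q\<^sub>1\<close> is used on \<open>c\<close> below \<open>i\<close> and on \<open>a\<close> above \<open>i\<close>.

  For the chords, a cycle that meets a leaf without being contained in it crosses the border of the
  leaf twice, once along an edge to the clique. The cycle has at most \<open>2(k - 3)\<close> edges at the clique,
  hence it visits at most \<open>2(k - 3)\<close> leaves. In a pentagon \<open>S\<^sub>i\<close> that the cycle does not leave through
  the stem of a leaf, the vertices \<open>b\<^sub>i, d\<^sub>i, t\<^sub>i\<close> have degree two in what the cycle can use, so no edge
  of \<open>S\<^sub>i\<close> is a chord, and neither is \<open>c\<^sub>ia\<^bsub>i+1\<^esub>\<close>. All chords are thus located in the clique or at one of
  boundedly many leaves and pentagons.\<close>

section \<open>Cycles\<close>

text \<open>Otherwise \<open>X\<close> would be closed under the cyclic successor, and the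
  successors of \<open>a\<close> run through all positions.\<close>

lemma cycle_edges_exit:
  assumes "a \<in> set c" "a \<in> X" "\<not> set c \<subseteq> X"
  shows "\<exists>i<length c. c ! i \<in> X \<and> c ! (Suc i mod length c) \<notin> X"
proof (rule ccontr)
  let ?n = "length c"
  assume "\<not> ?thesis"
  then have step: "c ! (Suc i mod ?n) \<in> X" if "i < ?n" "c ! i \<in> X" for i
    using that by blast
  obtain s where s: "s < ?n" "c ! s = a"
    using assms(1) by (auto simp: in_set_conv_nth)
  then have "?n > 0" by linarith
  have all: "c ! ((s + t) mod ?n) \<in> X" for t
  proof (induction t)
    case 0
    then show ?case using s assms(2) by simp
  next
    case (Suc t)
    show ?case
      using step[of "(s + t) mod ?n"] Suc \<open>?n > 0\<close> by (simp add: mod_Suc_eq)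
  qed
  have "c ! i \<in> X" if "i < ?n" for i
  proof -
    \<comment> \<open>The offset completes the current turn from position \<open>s\<close> and then
      advances to position \<open>i\<close>.\<close>
    have "(s + (?n - s + i)) mod ?n = i"
      using s that by simp
    then show ?thesis using all by metis
  qed
  then show False using assms(3) by (auto simp: in_set_conv_nth)
qed

text \<open>One edge leaves \<open>X\<close> and one leaves its complement. Were they equal, their
  start positions would be each other's cyclic successors, which is impossible with at least three
  vertices.\<close>

lemma cycle_edges_crossing:
  assumes "3 \<le> length c" "distinct c" "a \<in> set c" "a \<in> X" "\<not> set c \<subseteq> X"
  obtains x y x' y' where "x \<in> X" "y \<notin> X" "x' \<in> X" "y' \<notin> X"
    "{x, y} \<in> cycle_edges c" "{x', y'} \<in> cycle_edges c" "{x, y} \<noteq> {x', y'}"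
proof -
  let ?n = "length c"
  obtain i where i: "i < ?n" "c ! i \<in> X" "c ! (Suc i mod ?n) \<notin> X"
    using cycle_edges_exit[OF assms(3-5)] by blast
  obtain b where "b \<in> set c" "b \<in> - X"
    using assms(5) by blast
  then obtain j where j: "j < ?n" "c ! j \<notin> X" "c ! (Suc j mod ?n) \<in> X"
    using cycle_edges_exit[of b c "- X"] assms(3,4) by fastforce
  have "{c ! i, c ! (Suc i mod ?n)} \<noteq> {c ! (Suc j mod ?n), c ! j}"
  proof
    assume "{c ! i, c ! (Suc i mod ?n)} = {c ! (Suc j mod ?n), c ! j}"
    then have "c ! i = c ! (Suc j mod ?n)" "c ! (Suc i mod ?n) = c ! j"
      using i j unfolding doubleton_eq_iff by metis+
    moreover have "Suc j mod ?n < ?n" "Suc i mod ?n < ?n"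
      using i by (auto intro!: mod_less_divisor)
    ultimately have "i = Suc j mod ?n" "j = Suc i mod ?n"
      using i(1) j(1) nth_eq_iff_index_eq[OF \<open>distinct c\<close>] by metis+
    moreover have "Suc i mod ?n = (if Suc i = ?n then 0 else Suc i)"
      "Suc j mod ?n = (if Suc j = ?n then 0 else Suc j)"
      using i(1) j(1) by (simp_all add: mod_Suc)
    ultimately have "i = 0 \<and> Suc j = ?n \<or> i = Suc j" "j = 0 \<and> Suc i = ?n \<or> j = Suc i"
      by metis+
    then show False
      using assms(1) by linarith
  qed
  moreover have "{c ! i, c ! (Suc i mod ?n)} \<in> cycle_edges c"
    "{c ! (Suc j mod ?n), c ! j} \<in> cycle_edges c"
    using i(1) j(1) unfolding cycle_edges_def by (blast, subst insert_commute, blast)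
  ultimately show ?thesis
    using that i j by blast
qed

lemma cycle_edges_two:
  assumes "3 \<le> length c" "distinct c" "v \<in> set c"
  obtains y y' where "y \<noteq> y'" "{v, y} \<in> cycle_edges c" "{v, y'} \<in> cycle_edges c"
proof -
  have "\<not> set c \<subseteq> {v}"
  proof
    assume "set c \<subseteq> {v}"
    then have "card (set c) \<le> 1"
      by (metis One_nat_def card.empty card_insert_if card_mono empty_iff finite.emptyI finite_insert)
    then show False using assms by (simp add: distinct_card)
  qed
  then obtain x y x' y' where "x \<in> {v}" "y \<notin> {v}" "x' \<in> {v}" "y' \<notin> {v}"
    "{x, y} \<in> cycle_edges c" "{x', y'} \<in> cycle_edges c" "{x, y} \<noteq> {x', y'}"
    using cycle_edges_crossing[OF assms, of "{v}"] by (metis singletonI)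
  then show ?thesis
    using that[of y y'] by auto
qed

lemma finite_cycle_edges [simp]: "finite (cycle_edges c)"
  unfolding cycle_edges_def by simp

lemma cycle_edges_subset: "e \<in> cycle_edges c \<Longrightarrow> e \<subseteq> set c"
  unfolding cycle_edges_def by (auto intro!: nth_mem mod_less_divisor)

text \<open>An edge at \<open>v\<close> starts at the position of \<open>v\<close> or at the
  position before it; distinctness makes both positions unique.\<close>

lemma card_cycle_edges_at:
  assumes "distinct c"
  shows "card {e \<in> cycle_edges c. v \<in> e} \<le> 2"
proof -
  let ?n = "length c"
  let ?e = "\<lambda>i. {c ! i, c ! (Suc i mod ?n)}"
  let ?I = "{i. i < ?n \<and> c ! i = v}" and ?J = "{i. i < ?n \<and> c ! (Suc i mod ?n) = v}"
  have "\<And>i j. i \<in> ?I \<Longrightarrow> j \<in> ?I \<Longrightarrow> i = j"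
    using assms by (auto simp: nth_eq_iff_index_eq)
  then have "card ?I \<le> 1"
    by (simp add: card_le_Suc0_iff_eq)
  moreover have "\<And>i j. i \<in> ?J \<Longrightarrow> j \<in> ?J \<Longrightarrow> i = j"
  proof -
    fix i j assume ij: "i \<in> ?J" "j \<in> ?J"
    then have "Suc i mod ?n = Suc j mod ?n"
      using nth_eq_iff_index_eq[OF assms, of "Suc i mod ?n" "Suc j mod ?n"]
      by (metis (mono_tags, lifting) gr_implies_not_zero mem_Collect_eq mod_less_divisor neq0_conv)
    then show "i = j" using ij by (auto simp: mod_Suc split: if_splits)
  qed
  then have "card ?J \<le> 1"
    by (simp add: card_le_Suc0_iff_eq)
  moreover have "{e \<in> cycle_edges c. v \<in> e} \<subseteq> ?e ` (?I \<union> ?J)"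
    unfolding cycle_edges_def by auto
  then have "card {e \<in> cycle_edges c. v \<in> e} \<le> card (?I \<union> ?J)"
    by (intro surj_card_le) auto
  ultimately show ?thesis
    using card_Un_le[of ?I ?J] by linarith
qed

lemma card_cycle_edges_meeting:
  assumes "distinct c" "finite A"
  shows "card {e \<in> cycle_edges c. e \<inter> A \<noteq> {}} \<le> 2 * card A"
proof -
  have "{e \<in> cycle_edges c. e \<inter> A \<noteq> {}} = (\<Union>v\<in>A. {e \<in> cycle_edges c. v \<in> e})"
    by auto
  then have "card {e \<in> cycle_edges c. e \<inter> A \<noteq> {}} \<le> (\<Sum>v\<in>A. card {e \<in> cycle_edges c. v \<in> e})"
    using card_UN_le[OF assms(2)] by metis
  also have "\<dots> \<le> (\<Sum>v\<in>A. 2)"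
    using card_cycle_edges_at[OF assms(1)] by (intro sum_mono)
  finally show ?thesis by (simp add: mult.commute)
qed

lemma chordsD:
  assumes "d \<in> chords G c"
  shows "d \<in> edges G" "d \<subseteq> set c" "d \<notin> cycle_edges c"
  using assms unfolding chords_def by auto

section \<open>Images of graphs under injections\<close>

text \<open>Carries the graphs from \<open>hvert\<close> over to \<open>nat\<close>, the vertex type
  of the infinite family.\<close>

definition map_graph :: "('a \<Rightarrow> 'b) \<Rightarrow> 'a sgraph \<Rightarrow> 'b sgraph" where
  "map_graph f G = \<lparr>verts = f ` verts G, edges = (`) f ` edges G\<rparr>"

lemma map_graph_sel [simp]:
  "verts (map_graph f G) = f ` verts G" "edges (map_graph f G) = (`) f ` edges G"
  by (simp_all add: map_graph_def)

lemma inj_image_doubleton_iff: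
  assumes "inj f"
  shows "{f x, f y} \<in> (`) f ` E \<longleftrightarrow> {x, y} \<in> E"
proof -
  have "inj ((`) f)"
    using assms by (simp add: inj_def inj_image_eq_iff)
  then show ?thesis
    using inj_image_mem_iff[of "(`) f" "{x, y}" E] by simp
qed

lemma simple_graph_map:
  assumes "inj f" "simple_graph G"
  shows "simple_graph (map_graph f G)"
proof -
  have "card (f ` e) = card e" for e
    using assms(1) by (simp add: card_image inj_on_subset)
  then show ?thesis
    using assms(2) unfolding simple_graph_def by auto
qed

lemma colorable_map_iff:
  assumes "inj f"
  shows "colorable n (map_graph f G) \<longleftrightarrow> colorable n G"
proof
  assume "colorable n (map_graph f G)"
  then obtain g where "\<forall>x\<in>f ` verts G. g x < n" "\<forall>x y. {x, y} \<in> (`) f ` edges G \<longrightarrow> g x \<noteq> g y"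
    unfolding colorable_def by auto
  then show "colorable n G"
    unfolding colorable_def using inj_image_doubleton_iff[OF assms]
    by (intro exI[of _ "g \<circ> f"]) auto
next
  assume "colorable n G"
  then obtain g where g: "\<forall>x\<in>verts G. g x < n" "\<And>x y. {x, y} \<in> edges G \<Longrightarrow> g x \<noteq> g y"
    unfolding colorable_def by auto
  have "g (inv f x) \<noteq> g (inv f y)" if "{x, y} \<in> (`) f ` edges G" for x y
  proof -
    from that obtain e where e: "e \<in> edges G" "{x, y} = f ` e" by auto
    then have "inv f ` {x, y} = e" using assms by (simp add: image_inv_f_f)
    then have "{inv f x, inv f y} \<in> edges G" using e(1) by simp
    then show ?thesis using g(2) by blast
  qed
  then show "colorable n (map_graph f G)"
    unfolding colorable_def using assms g(1)
    by (intro exI[of _ "g \<circ> inv f"]) auto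
qed

text \<open>Criticality speaks about all subgraphs of the image, so each of them has to be pulled
  back. Its vertices lie in the range of \<open>f\<close>, where \<open>inv f\<close> is a two-sided
  inverse.\<close>

lemma proper_subgraph_map_inv:
  assumes "inj f" "proper_subgraph H (map_graph f G)"
  shows "proper_subgraph (map_graph (inv f) H) G" "map_graph f (map_graph (inv f) H) = H"
proof -
  have H: "simple_graph H" "verts H \<subseteq> f ` verts G" "edges H \<subseteq> (`) f ` edges G" "H \<noteq> map_graph f G"
    using assms(2) unfolding proper_subgraph_def subgraph_def by auto
  have fi: "f (inv f x) = x" if "x \<in> verts H" for x
    using that H(2) by (auto simp: f_inv_into_f)
  have fie: "f ` inv f ` e = e" "e \<subseteq> verts H" if "e \<in> edges H" for e
  proof -
    show "e \<subseteq> verts H" using that H(1) unfolding simple_graph_def by auto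
    then show "f ` inv f ` e = e" using fi by (force simp: image_image)
  qed
  have v: "f ` inv f ` verts H = verts H" using fi by (force simp: image_image)
  have e: "(`) f ` (`) (inv f) ` edges H = edges H"
    using fie(1) by (force simp: image_image)
  show eq: "map_graph f (map_graph (inv f) H) = H"
    using v e by (simp add: map_graph_def)
  have "card (inv f ` e) = 2" if "e \<in> edges H" for e
  proof -
    have "inj_on (inv f) e"
      using fie(2)[OF that] fi by (metis inj_on_inverseI subsetD)
    then show ?thesis
      using H(1) that unfolding simple_graph_def by (simp add: card_image)
  qed
  then have s: "simple_graph (map_graph (inv f) H)"
    using H(1) unfolding simple_graph_def by fastforce
  have "map_graph (inv f) H \<noteq> G"
    using eq H(4) by auto
  moreover have "inv f ` verts H \<subseteq> verts G"
    using H(2) assms(1) by auto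
  moreover have "(`) (inv f) ` edges H \<subseteq> edges G"
  proof -
    have "(`) (inv f) ` edges H \<subseteq> (`) (inv f) ` (`) f ` edges G"
      using H(3) by (rule image_mono)
    also have "\<dots> = edges G"
      using assms(1) by (simp add: image_inv_f_f image_image cong: image_cong)
    finally show ?thesis .
  qed
  ultimately show "proper_subgraph (map_graph (inv f) H) G"
    using s unfolding proper_subgraph_def subgraph_def by simp
qed

lemma critical_map:
  assumes "inj f" "critical k G"
  shows "critical k (map_graph f G)"
  unfolding critical_def
proof (intro conjI allI impI)
  show "chromatic_number (map_graph f G) = k"
    using assms by (simp add: critical_def chromatic_number_def colorable_map_iff)
  fix H assume "proper_subgraph H (map_graph f G)"
  note H = proper_subgraph_map_inv[OF assms(1) this]
  then have "colorable (k - 1) (map_graph (inv f) H)"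
    using assms(2) unfolding critical_def by blast
  then show "colorable (k - 1) H"
    using colorable_map_iff[OF assms(1), of "k - 1" "map_graph (inv f) H"] H(2) by simp
qed

lemma cycle_edges_map: "cycle_edges (map f c) = (`) f ` cycle_edges c"
proof -
  have eq: "cycle_edges d = (\<lambda>i. {d ! i, d ! (Suc i mod length d)}) ` {..<length d}" for d :: "'x list"
    unfolding cycle_edges_def by auto
  have "{map f c ! i, map f c ! (Suc i mod length c)} = f ` {c ! i, c ! (Suc i mod length c)}"
    if "i < length c" for i
  proof -
    have "Suc i mod length c < length c"
      using that by (intro mod_less_divisor) linarith
    then show ?thesis using that by simp
  qed
  then show ?thesis
    unfolding eq image_image length_map by (intro image_cong) auto
qed

text \<open>Every vertex of a cycle lies on an edge of the image graph, hence in the range of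
  \<open>f\<close>, so the whole list can be pulled back.\<close>

lemma is_cycle_mapE:
  assumes "inj f" "is_cycle (map_graph f G) c"
  obtains d where "c = map f d" "is_cycle G d"
proof -
  have c: "3 \<le> length c" "distinct c" "cycle_edges c \<subseteq> (`) f ` edges G"
    using assms(2) unfolding is_cycle_def by auto
  have "set c \<subseteq> range f"
  proof
    fix v assume "v \<in> set c"
    then obtain y where "{v, y} \<in> cycle_edges c" using cycle_edges_two[OF c(1,2)] by metis
    then obtain e where "{v, y} = f ` e" using c(3) by blast
    then show "v \<in> range f" by blast
  qed
  then have "map f (map (inv f) c) = c"
    by (auto intro!: map_idI simp: f_inv_into_f subset_iff)
  then obtain d where d: "c = map f d"
    by metis
  have "inj ((`) f)"
    using assms(1) by (simp add: inj_def inj_image_eq_iff)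
  then have "cycle_edges d \<subseteq> edges G"
    using c(3) unfolding d cycle_edges_map by (simp add: inj_image_subset_iff)
  then show ?thesis
    using that d c assms(1) unfolding is_cycle_def by (auto simp: distinct_map)
qed

lemma chords_map:
  assumes "inj f"
  shows "chords (map_graph f G) (map f c) = (`) f ` chords G c"
proof
  show "(`) f ` chords G c \<subseteq> chords (map_graph f G) (map f c)"
  proof
    fix e assume "e \<in> (`) f ` chords G c"
    then obtain x y where "e = {f x, f y}" "{x, y} \<in> edges G" "x \<in> set c" "y \<in> set c"
      "{x, y} \<notin> cycle_edges c"
      unfolding chords_def by auto
    then have "e = {f x, f y}" "{f x, f y} \<in> edges (map_graph f G)"
      "f x \<in> set (map f c)" "f y \<in> set (map f c)" "{f x, f y} \<notin> cycle_edges (map f c)"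
      by (simp_all add: cycle_edges_map inj_image_doubleton_iff[OF assms])
    then show "e \<in> chords (map_graph f G) (map f c)"
      unfolding chords_def by blast
  qed
  show "chords (map_graph f G) (map f c) \<subseteq> (`) f ` chords G c"
  proof
    fix e assume "e \<in> chords (map_graph f G) (map f c)"
    then obtain x y where xy: "e = {f x, f y}" "{f x, f y} \<in> (`) f ` edges G" "x \<in> set c" "y \<in> set c"
      "{f x, f y} \<notin> (`) f ` cycle_edges c"
      unfolding chords_def cycle_edges_map by auto
    from xy(2,5) have "{x, y} \<in> edges G" "{x, y} \<notin> cycle_edges c"
      by (simp_all add: inj_image_doubleton_iff[OF assms])
    with xy(3,4) have "{x, y} \<in> chords G c"
      unfolding chords_def by blast
    then show "e \<in> (`) f ` chords G c" using xy(1) by (metis imageI image_empty image_insert)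
  qed
qed

lemma isomorphic_card: "isomorphic G H \<Longrightarrow> card (verts G) = card (verts H)"
  unfolding isomorphic_def using bij_betw_same_card by blast

section \<open>Critical graphs\<close>

lemma inj_on_doubleton: "inj_on f {x, y} \<longleftrightarrow> (f x = f y \<longrightarrow> x = y)"
  by (auto simp: inj_on_def)

lemma colorable_mono: "colorable n G \<Longrightarrow> n \<le> n' \<Longrightarrow> colorable n' G"
  unfolding colorable_def by (meson less_le_trans)

text \<open>Since every vertex of \<open>G\<close> lies on an edge, a proper subgraph misses some
  edge \<open>e\<close>, and a coloring of \<open>G\<close> without \<open>e\<close> restricts to
  it. Writing properness as \<open>inj_on f d\<close> treats edges as sets, without naming their
  ends.\<close>

lemma critical_if_edge_critical:
  assumes "simple_graph G" "k > 0" "\<not> colorable (k - 1) G" "edges G \<noteq> {}"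
    and cov: "\<And>v. v \<in> verts G \<Longrightarrow> \<exists>e\<in>edges G. v \<in> e"
    and del: "\<And>e. e \<in> edges G \<Longrightarrow>
      \<exists>f. (\<forall>v\<in>verts G. f v < k - 1) \<and> (\<forall>d\<in>edges G - {e}. inj_on f d)"
  shows "critical k G"
proof -
  have two: "x \<noteq> y" "x \<in> verts G" if "{x, y} \<in> edges G" for x y
    using that assms(1) unfolding simple_graph_def by force+
  obtain e where e: "e \<in> edges G" using assms(4) by blast
  then obtain a b where ab: "e = {a, b}"
    using assms(1) unfolding simple_graph_def by (metis card_2_iff)
  obtain f where f: "\<forall>v\<in>verts G. f v < k - 1" "\<forall>d\<in>edges G - {e}. inj_on f d"
    using del[OF e] by blast
  \<comment> \<open>One end of the deleted edge receives the fresh color \<open>k - 1\<close>, which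
    gives a coloring of all of \<open>G\<close> with \<open>k\<close> colors.\<close>
  have "(f(a := k - 1)) x \<noteq> (f(a := k - 1)) y" if "{x, y} \<in> edges G" for x y
  proof (cases "x = a \<or> y = a")
    case True
    moreover have "{y, x} \<in> edges G" using that by (simp add: insert_commute)
    ultimately show ?thesis
      using two[OF that] two[of y x] f(1) by fastforce
  next
    case False
    then have "{x, y} \<noteq> e" using ab by auto
    then have "inj_on f {x, y}" using f(2) that by blast
    then show ?thesis using False two(1)[OF that] by (auto simp: inj_on_doubleton)
  qed
  then have "colorable k G"
    unfolding colorable_def using f(1) assms(2)
    by (intro exI[of _ "f(a := k - 1)"]) force
  then have "chromatic_number G = k"
    unfolding chromatic_number_def
  proof (rule Least_equality)
    fix n assume "colorable n G"
    then show "k \<le> n"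
      using colorable_mono[of n G "k - 1"] assms(3) by fastforce
  qed
  moreover have "colorable (k - 1) H" if H: "proper_subgraph H G" for H
  proof -
    have sub: "simple_graph H" "verts H \<subseteq> verts G" "edges H \<subseteq> edges G" "H \<noteq> G"
      using H unfolding proper_subgraph_def subgraph_def by auto
    have "edges H \<noteq> edges G"
    proof
      assume eq: "edges H = edges G"
      then obtain v where "v \<in> verts G" "v \<notin> verts H"
        using sub(2,4) by (metis sgraph.equality subsetI subset_antisym unit_eq)
      then show False
        using cov eq sub(1) unfolding simple_graph_def by blast
    qed
    then obtain e where "e \<in> edges G" "e \<notin> edges H" using sub(3) by blast
    then obtain f where f: "\<forall>v\<in>verts G. f v < k - 1" "\<forall>d\<in>edges G - {e}. inj_on f d"
      using del by blast
    have "f x \<noteq> f y" if "{x, y} \<in> edges H" for x y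
    proof -
      have "inj_on f {x, y}" "{x, y} \<in> edges G"
        using that sub(3) f(2) \<open>e \<notin> edges H\<close> by auto
      then show ?thesis using two(1) by (auto simp: inj_on_doubleton)
    qed
    then show ?thesis
      unfolding colorable_def using f(1) sub(2) by blast
  qed
  ultimately show ?thesis unfolding critical_def by blast
qed

section \<open>The vertices and edges of the construction\<close>

lemma H_graph_edges:
  "edges (H_graph k m) =
     {{Clq h, Clq j} | h j. h \<in> {1..k-3} \<and> j \<in> {1..k-3} \<and> h \<noteq> j} \<union>
     (\<Union>i\<in>{0..m}. pentagon (Pent CA i) (Pent CB i) (Pent CC i) (Pent CD i) (Pent CT i)) \<union>
     {{Pent CC i, Pent CA (i + 1)} | i. i \<in> {0..<m}} \<union>
     (\<Union>(x, i, j)\<in>leaves (k-3) m. leaf_edges (k-3) x i j)"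
  by (simp add: H_graph_def Let_def)

lemma H_graph_edgesI:
  "h \<in> {1..k-3} \<Longrightarrow> j \<in> {1..k-3} \<Longrightarrow> h \<noteq> j \<Longrightarrow> {Clq h, Clq j} \<in> edges (H_graph k m)"
  "i \<le> m \<Longrightarrow> e \<in> pentagon (Pent CA i) (Pent CB i) (Pent CC i) (Pent CD i) (Pent CT i) \<Longrightarrow>
     e \<in> edges (H_graph k m)"
  "i < m \<Longrightarrow> {Pent CC i, Pent CA (i + 1)} \<in> edges (H_graph k m)"
  "(x, i, j) \<in> leaves (k-3) m \<Longrightarrow> e \<in> leaf_edges (k-3) x i j \<Longrightarrow> e \<in> edges (H_graph k m)"
  unfolding H_graph_edges by (blast, force, force, force)

lemma H_graph_edgesE:
  assumes "e \<in> edges (H_graph k m)"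
  obtains (Clique) h j where "h \<in> {1..k-3}" "j \<in> {1..k-3}" "h \<noteq> j" "e = {Clq h, Clq j}"
  | (Pentagon) i where "i \<le> m" "e \<in> pentagon (Pent CA i) (Pent CB i) (Pent CC i) (Pent CD i) (Pent CT i)"
  | (Connector) i where "i < m" "e = {Pent CC i, Pent CA (i + 1)}"
  | (Leaf_edge) x i j where "(x, i, j) \<in> leaves (k-3) m" "e \<in> leaf_edges (k-3) x i j"
  using assms unfolding H_graph_edges by (elim UnE) (use that in \<open>fastforce+\<close>)

lemma H_graph_verts:
  "verts (H_graph k m) = Clq ` {1..k-3} \<union> case_prod Pent ` (UNIV \<times> {0..m}) \<union>
     (\<lambda>((x, i, j), l). Leaf x i j l) ` (leaves (k-3) m \<times> UNIV)"
proof -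
  have "{Leaf x i j l | x i j l. (x, i, j) \<in> leaves (k-3) m} =
      (\<lambda>((x, i, j), l). Leaf x i j l) ` (leaves (k-3) m \<times> UNIV)"
    by force
  moreover have "{Pent x i | x i. i \<in> {0..m}} = case_prod Pent ` (UNIV \<times> {0..m})"
    by auto
  moreover have "{Clq j | j. j \<in> {1..k-3}} = Clq ` {1..k-3}"
    by auto
  ultimately show ?thesis
    unfolding H_graph_def Let_def by simp
qed

lemma H_graph_in_verts_iff [simp]:
  "Clq j \<in> verts (H_graph k m) \<longleftrightarrow> j \<in> {1..k-3}"
  "Pent x i \<in> verts (H_graph k m) \<longleftrightarrow> i \<le> m"
  "Leaf x i j l \<in> verts (H_graph k m) \<longleftrightarrow> (x, i, j) \<in> leaves (k-3) m"
  by (simp_all add: H_graph_def Let_def)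

lemma UNIV_corner: "UNIV = {CA, CB, CC, CD, CT}"
  using corner.exhaust by auto

lemma UNIV_leaf_vert: "UNIV = {LR, LU, LV, LW, LZ}"
  using leaf_vert.exhaust by auto

text \<open>Written as products, the index set can be counted; the grouping follows the disjoint
  unions used for the count.\<close>

lemma leaves_eq:
  "leaves p m = ({CB, CD, CT} \<times> {0..m} \<times> {1..p} \<union> {CA} \<times> {0} \<times> {1..p} \<union> {CC} \<times> {m} \<times> {1..p})
     \<union> ({CA} \<times> {1..m} \<times> {2..p} \<union> {CC} \<times> {0..<m} \<times> {2..p})"
proof -
  have "{(x, i, j) | x i j. x \<in> {CB, CD, CT} \<and> i \<in> {0..m} \<and> j \<in> {1..p}} = {CB, CD, CT} \<times> {0..m} \<times> {1..p}"
    "{(CA, 0::nat, j) | j. j \<in> {1..p}} = {CA} \<times> {0} \<times> {1..p}"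
    "{(CC, m, j) | j. j \<in> {1..p}} = {CC} \<times> {m} \<times> {1..p}"
    "{(CA, i, j) | i j. i \<in> {1..m} \<and> j \<in> {2..p}} = {CA} \<times> {1..m} \<times> {2..p}"
    "{(CC, i, j) | i j. i \<in> {0..<m} \<and> j \<in> {2..p}} = {CC} \<times> {0..<m} \<times> {2..p}"
    by blast+
  then show ?thesis
    unfolding leaves_def by (simp only: Un_assoc)
qed

lemma finite_leaves [simp]: "finite (leaves p m)"
  by (simp add: leaves_eq)

text \<open>The leaves left out are exactly those for \<open>Clq 1\<close> at the ends of the
  connectors, the only places where a pentagon may show the color of \<open>Clq 1\<close>.\<close>

lemma leaves_iff:
  "(x, i, j) \<in> leaves p m \<longleftrightarrow> i \<le> m \<and> 1 \<le> j \<and> j \<le> p \<and>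
     (x = CA \<and> i > 0 \<longrightarrow> j \<noteq> 1) \<and> (x = CC \<and> i < m \<longrightarrow> j \<noteq> 1)"
  unfolding leaves_eq by (cases x; simp; linarith)

text \<open>There would be \<open>p\<close> leaves at each of the 5(m + 1) pentagon vertices, but
  one is missing at each of the 2m ends of connectors.\<close>

lemma card_leaves:
  assumes "p \<ge> 1"
  shows "int (card (leaves p m)) = 5 * int m * int p + 5 * int p - 2 * int m"
proof -
  let ?A = "{CB, CD, CT} \<times> {0..m} \<times> {1..p}" and ?B = "{CA} \<times> {0::nat} \<times> {1..p}"
    and ?C = "{CC} \<times> {m} \<times> {1..p}" and ?D = "{CA} \<times> {1..m} \<times> {2..p}"
    and ?E = "{CC} \<times> {0..<m} \<times> {2..p}"
  have "card (leaves p m) = card (?A \<union> ?B \<union> ?C) + card (?D \<union> ?E)"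
    unfolding leaves_eq by (rule card_Un_disjoint) auto
  also have "card (?A \<union> ?B \<union> ?C) = card (?A \<union> ?B) + card ?C"
    by (rule card_Un_disjoint) auto
  also have "card (?A \<union> ?B) = card ?A + card ?B"
    by (rule card_Un_disjoint) auto
  also have "card (?D \<union> ?E) = card ?D + card ?E"
    by (rule card_Un_disjoint) auto
  finally have "card (leaves p m) = card ?A + card ?B + card ?C + (card ?D + card ?E)" .
  moreover obtain q where "p = Suc q"
    using assms by (cases p) auto
  ultimately show ?thesis
    by (simp add: card_cartesian_product algebra_simps)
qed

text \<open>With p = k - 3 the total is p + 5(m + 1) plus five vertices for each leaf.\<close>

lemma card_H_graph_verts:
  assumes "k \<ge> 4"
  shows "int (card (verts (H_graph k m))) = (25 * int k - 80) * int m + 26 * int k - 73"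
proof -
  have "card (verts (H_graph k m)) = card (Clq ` {1..k-3}) + card (case_prod Pent ` (UNIV \<times> {0..m}))
     + card ((\<lambda>((x, i, j), l). Leaf x i j l) ` (leaves (k-3) m \<times> UNIV))"
    unfolding H_graph_verts
    by (subst card_Un_disjoint; (simp only: finite_imageI finite_SigmaI finite_Un finite_leaves finite_atLeastAtMost UNIV_corner UNIV_leaf_vert finite.intros)?; auto)+
  also have "card (Clq ` {1..k-3}) = k - 3"
    by (subst card_image) (auto simp: inj_on_def)
  also have "card (case_prod Pent ` (UNIV \<times> {0..m})) = 5 * (m + 1)"
    by (subst card_image) (auto simp: inj_on_def card_cartesian_product UNIV_corner)
  also have "card ((\<lambda>((x, i, j), l). Leaf x i j l) ` (leaves (k-3) m \<times> UNIV)) = card (leaves (k-3) m) * 5"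
    by (subst card_image) (auto simp: inj_on_def card_cartesian_product UNIV_leaf_vert)
  finally have card: "card (verts (H_graph k m)) = k - 3 + 5 * (m + 1) + card (leaves (k-3) m) * 5" .
  obtain q where "k = q + 4"
    using assms by (metis add.commute le_Suc_ex)
  then show ?thesis
    using card card_leaves[of "k - 3" m] by (simp add: algebra_simps)
qed

lemma simple_H_graph: "simple_graph (H_graph k m)"
proof -
  have "finite (verts (H_graph k m))"
    by (simp add: H_graph_verts UNIV_corner UNIV_leaf_vert)
  moreover have "e \<subseteq> verts (H_graph k m) \<and> card e = 2" if "e \<in> edges (H_graph k m)" for e
    using that
  proof (cases rule: H_graph_edgesE)
    case (Leaf_edge x i j)
    then have "i \<le> m" "j \<in> {1..k-3}" by (auto simp: leaves_iff)
    with Leaf_edge show ?thesis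
      by (auto simp: leaf_edges_def pentagon_def)
  qed (auto simp: pentagon_def)
  ultimately show ?thesis unfolding simple_graph_def by blast
qed

lemma H_graph_vert_in_edge:
  assumes "k \<ge> 4" "v \<in> verts (H_graph k m)"
  shows "\<exists>e\<in>edges (H_graph k m). v \<in> e"
proof (cases v)
  case (Clq j)
  then have "j \<in> {1..k - 3}"
    using assms(2) by simp
  \<comment> \<open>For k = 4 the clique has no edge of its own, so the edge is taken from the leaf
    \<open>L_1(b_0)\<close>.\<close>
  then have "{Leaf CB 0 1 LU, Clq j} \<in> leaf_edges (k - 3) CB 0 1"
    by (auto simp: leaf_edges_def)
  moreover have "(CB, 0, 1) \<in> leaves (k - 3) m"
    using assms(1) by (simp add: leaves_iff)
  ultimately have "{Leaf CB 0 1 LU, Clq j} \<in> edges (H_graph k m)"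
    by (intro H_graph_edgesI(4))
  then show ?thesis unfolding Clq by blast
next
  case (Pent x i)
  then have "i \<le> m"
    using assms(2) by simp
  obtain e where "e \<in> pentagon (Pent CA i) (Pent CB i) (Pent CC i) (Pent CD i) (Pent CT i)" "v \<in> e"
    unfolding Pent pentagon_def by (cases x) auto
  with \<open>i \<le> m\<close> show ?thesis
    using H_graph_edgesI(2)[of i m e k] by blast
next
  case (Leaf x i j l)
  then have "(x, i, j) \<in> leaves (k - 3) m"
    using assms(2) by simp
  moreover have "\<exists>e\<in>leaf_edges (k - 3) x i j. v \<in> e"
    unfolding Leaf leaf_edges_def pentagon_def by (cases l) auto
  ultimately show ?thesis
    using H_graph_edgesI(4)[of x i j k m] by blast
qed

lemma edge_PentD:
  assumes "{Pent x i, y} \<in> edges (H_graph k m)"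
  shows "(\<exists>j. y = Leaf x i j LR \<and> (x, i, j) \<in> leaves (k - 3) m) \<or>
    (\<exists>x'. y = Pent x' i \<and> {x, x'} \<in> pentagon CA CB CC CD CT) \<or>
    (x = CC \<and> y = Pent CA (i + 1)) \<or> (x = CA \<and> i > 0 \<and> y = Pent CC (i - 1))"
  using assms by (cases rule: H_graph_edgesE) (auto simp: leaf_edges_def pentagon_def doubleton_eq_iff)

lemma edge_LeafD:
  assumes "{Leaf x i j l, y} \<in> edges (H_graph k m)"
  shows "(\<exists>h\<in>{1..k - 3}. y = Clq h) \<or> (\<exists>l'. y = Leaf x i j l') \<or> (l = LR \<and> y = Pent x i)"
  using assms by (cases rule: H_graph_edgesE) (auto simp: leaf_edges_def pentagon_def doubleton_eq_iff)

section \<open>Colorings after the deletion of an edge\<close>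

fun corner_pos :: "corner \<Rightarrow> nat" where
  "corner_pos CA = 0" | "corner_pos CB = 1" | "corner_pos CC = 2" | "corner_pos CD = 3" | "corner_pos CT = 4"

fun leaf_pos :: "leaf_vert \<Rightarrow> nat" where
  "leaf_pos LR = 0" | "leaf_pos LU = 1" | "leaf_pos LV = 2" | "leaf_pos LW = 3" | "leaf_pos LZ = 4"

text \<open>Colors the vertex \<open>s\<close> of a 5-cycle by \<open>\<gamma>\<close> and the four others, in cyclic order, by 1, 0, 1, 0.
  With \<open>\<gamma> = 0\<close> the only monochromatic edge joins \<open>s\<close> to its predecessor.\<close>

definition ring_color :: "nat \<Rightarrow> nat \<Rightarrow> nat \<Rightarrow> nat" where
  "ring_color s \<gamma> b = (let d = (b + 5 - s) mod 5 in if d = 0 then \<gamma> else d mod 2)"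

definition pent_color :: "corner \<Rightarrow> nat \<Rightarrow> corner \<Rightarrow> nat" where
  "pent_color s \<gamma> x = ring_color (corner_pos s) \<gamma> (corner_pos x)"

definition leaf_color :: "leaf_vert \<Rightarrow> nat \<Rightarrow> leaf_vert \<Rightarrow> nat" where
  "leaf_color s \<gamma> l = ring_color (leaf_pos s) \<gamma> (leaf_pos l)"

lemma pent_color_cases: "x = s \<and> pent_color s \<gamma> x = \<gamma> \<or> x \<noteq> s \<and> pent_color s \<gamma> x < 2"
  by (cases s; cases x) (simp_all add: pent_color_def ring_color_def)

lemma leaf_color_cases: "l = s \<and> leaf_color s \<gamma> l = \<gamma> \<or> l \<noteq> s \<and> leaf_color s \<gamma> l < 2"
  by (cases s; cases l) (simp_all add: leaf_color_def ring_color_def)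

text \<open>Without \<open>s\<close> the cycle is a path colored alternately by 1 and 0, and
  \<gamma> differs from both.\<close>

lemma pent_color_proper:
  assumes "\<gamma> \<ge> 2" "d \<in> pentagon CA CB CC CD CT"
  shows "inj_on (pent_color s \<gamma>) d"
  using assms unfolding pentagon_def
  by (cases s) (auto simp: inj_on_doubleton pent_color_def ring_color_def)

lemma leaf_color_proper:
  assumes "\<gamma> \<ge> 2" "d \<in> pentagon LR LU LV LW LZ"
  shows "inj_on (leaf_color s \<gamma>) d"
  using assms unfolding pentagon_def
  by (cases s) (auto simp: inj_on_doubleton leaf_color_def ring_color_def)

text \<open>The vertex \<open>s\<close> is the later end of \<open>e\<close> in cyclic order, so
  that the single monochromatic edge is \<open>e\<close>.\<close>

lemma pent_color_proper_off:
  assumes "e \<in> pentagon CA CB CC CD CT"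
  obtains s where "\<And>d. d \<in> pentagon CA CB CC CD CT - {e} \<Longrightarrow> inj_on (pent_color s 0) d"
proof -
  have "\<exists>s. \<forall>d\<in>pentagon CA CB CC CD CT - {e}. inj_on (pent_color s 0) d"
    using assms unfolding pentagon_def
    apply (elim insertE emptyE)
    subgoal by (rule exI[of _ CB]) (auto simp: inj_on_doubleton pent_color_def ring_color_def)
    subgoal by (rule exI[of _ CC]) (auto simp: inj_on_doubleton pent_color_def ring_color_def)
    subgoal by (rule exI[of _ CD]) (auto simp: inj_on_doubleton pent_color_def ring_color_def)
    subgoal by (rule exI[of _ CT]) (auto simp: inj_on_doubleton pent_color_def ring_color_def)
    subgoal by (rule exI[of _ CA]) (auto simp: inj_on_doubleton pent_color_def ring_color_def)
    done
  then show ?thesis using that by blast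
qed

lemma leaf_color_proper_off:
  assumes "e \<in> pentagon LR LU LV LW LZ"
  obtains s where "\<And>d. d \<in> pentagon LR LU LV LW LZ - {e} \<Longrightarrow> inj_on (leaf_color s 0) d"
proof -
  have "\<exists>s. \<forall>d\<in>pentagon LR LU LV LW LZ - {e}. inj_on (leaf_color s 0) d"
    using assms unfolding pentagon_def
    apply (elim insertE emptyE)
    subgoal by (rule exI[of _ LU]) (auto simp: inj_on_doubleton leaf_color_def ring_color_def)
    subgoal by (rule exI[of _ LV]) (auto simp: inj_on_doubleton leaf_color_def ring_color_def)
    subgoal by (rule exI[of _ LW]) (auto simp: inj_on_doubleton leaf_color_def ring_color_def)
    subgoal by (rule exI[of _ LZ]) (auto simp: inj_on_doubleton leaf_color_def ring_color_def)
    subgoal by (rule exI[of _ LR]) (auto simp: inj_on_doubleton leaf_color_def ring_color_def)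
    done
  then show ?thesis using that by blast
qed

section \<open>Colorings assembled from the clique, the pentagons and the leaves\<close>

lemma pentagon_image: "pentagon (f a) (f b) (f c) (f d) (f t) = (`) f ` pentagon a b c d t"
  by (simp add: pentagon_def)

lemma inj_on_pentagon_image:
  assumes "\<And>x. F (g x) = h x" "inj_on h d"
  shows "inj_on F (g ` d)"
  using assms by (auto simp: inj_on_def)

text \<open>The shift by one at the clique reserves 0 and 1 as the two colors free of the clique.
  The pentagons are colored by \<open>P\<close>, level by level, and the leaves by
  \<open>c\<close>.\<close>

fun H_color :: "(nat \<Rightarrow> corner \<Rightarrow> nat) \<Rightarrow> (corner \<Rightarrow> nat \<Rightarrow> nat \<Rightarrow> leaf_vert \<Rightarrow> nat) \<Rightarrow> hvert \<Rightarrow> nat" where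
  "H_color P c (Clq j) = j + 1"
| "H_color P c (Pent x i) = P i x"
| "H_color P c (Leaf x i j l) = c x i j l"

text \<open>The color 2 is the one of \<open>Clq 1\<close>; it may appear on \<open>c\<close> before the level \<open>i\<^sub>0\<close> and on \<open>a\<close>
  after it, and the level itself is colored by \<open>g\<close>.\<close>

definition level_color :: "nat \<Rightarrow> (corner \<Rightarrow> nat) \<Rightarrow> nat \<Rightarrow> corner \<Rightarrow> nat" where
  "level_color i\<^sub>0 g i =
     (if i < i\<^sub>0 then pent_color CC 2 else if i = i\<^sub>0 then g else pent_color CA 2)"

lemma leaf_edges_cases:
  assumes "d \<in> leaf_edges p x i j"
  obtains (Ring) d' where "d' \<in> pentagon LR LU LV LW LZ" "d = Leaf x i j ` d'"
  | (Stem) "d = {Pent x i, Leaf x i j LR}"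
  | (Join) l h where "h \<in> {1..p}" "l \<noteq> LR \<or> h \<noteq> j" "d = {Leaf x i j l, Clq h}"
  using assms unfolding leaf_edges_def pentagon_image by blast

text \<open>Each condition is tied to the edge \<open>d\<close> itself, so that a deleted edge of
  the leaf can be exempted.\<close>

lemma H_color_leaf_edge:
  assumes "d \<in> leaf_edges p x i j"
    and "\<And>d'. d' \<in> pentagon LR LU LV LW LZ \<Longrightarrow> d = Leaf x i j ` d' \<Longrightarrow> inj_on (c x i j) d'"
    and "d = {Pent x i, Leaf x i j LR} \<Longrightarrow> P i x \<noteq> c x i j LR"
    and "\<And>l h. h \<in> {1..p} \<Longrightarrow> l \<noteq> LR \<or> h \<noteq> j \<Longrightarrow> d = {Leaf x i j l, Clq h} \<Longrightarrow> c x i j l \<noteq> h + 1"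
  shows "inj_on (H_color P c) d"
  using assms(1)
proof (cases rule: leaf_edges_cases)
  case (Ring d')
  show ?thesis
    unfolding Ring(2) using assms(2)[OF Ring] by (intro inj_on_pentagon_image) auto
next
  case Stem
  show ?thesis
    unfolding Stem using assms(3)[OF Stem] by (simp add: inj_on_doubleton)
next
  case (Join l h)
  show ?thesis
    unfolding Join(3) using assms(4)[OF Join] by (simp add: inj_on_doubleton)
qed

lemma leaf_color_neq:
  assumes "h \<ge> 1" "l \<noteq> s \<or> \<gamma> \<noteq> h + 1"
  shows "leaf_color s \<gamma> l \<noteq> h + 1"
  using assms leaf_color_cases[of l s \<gamma>] by auto

text \<open>In an intact leaf the root takes the color of the one clique vertex it is not joined to,
  and the rest of the ring alternates between 0 and 1.\<close>

lemma leaf_color_edge: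
  assumes "d \<in> leaf_edges p x i j" "c x i j = leaf_color LR (j + 1)" "P i x \<noteq> j + 1" "j \<ge> 1"
  shows "inj_on (H_color P c) d"
proof (rule H_color_leaf_edge[OF assms(1)])
  show "P i x \<noteq> c x i j LR"
    using leaf_color_cases[of LR LR "j + 1"] assms(2,3) by simp
  show "c x i j l \<noteq> h + 1" if "h \<in> {1..p}" "l \<noteq> LR \<or> h \<noteq> j" for l h
    unfolding assms(2) by (rule leaf_color_neq) (use that in auto)
qed (use assms(2,4) in \<open>simp add: leaf_color_proper\<close>)

text \<open>A damaged leaf tolerates the color of \<open>Clq j\<close> at the vertex it hangs from.
  If a ring edge is missing, the ring needs only 0 and 1; if the stem is missing, the usual coloring
  works; if the edge from \<open>l\<close> to \<open>Clq h\<close> is missing, \<open>l\<close>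
  takes over the color of \<open>Clq h\<close>.\<close>

lemma leaf_color_edge_off:
  assumes "e \<in> leaf_edges p x i j" "j \<in> {1..p}"
  obtains s \<gamma> where "\<gamma> < p + 2" "\<And>P c d. d \<in> leaf_edges p x i j \<Longrightarrow> d \<noteq> e \<Longrightarrow> P i x = j + 1 \<Longrightarrow>
     c x i j = leaf_color s \<gamma> \<Longrightarrow> inj_on (H_color P c) d"
  using assms(1)
proof (cases rule: leaf_edges_cases)
  case (Ring e')
  obtain s where s: "\<And>d. d \<in> pentagon LR LU LV LW LZ - {e'} \<Longrightarrow> inj_on (leaf_color s 0) d"
    using leaf_color_proper_off Ring(1) by blast
  show ?thesis
  proof (rule that[of 0 s])
    fix P c d
    assume d: "d \<in> leaf_edges p x i j" "d \<noteq> e" and P: "P i x = j + 1" and c: "c x i j = leaf_color s 0"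
    show "inj_on (H_color P c) d"
    proof (rule H_color_leaf_edge[OF d(1)])
      show "inj_on (c x i j) d'" if "d' \<in> pentagon LR LU LV LW LZ" "d = Leaf x i j ` d'" for d'
        unfolding c by (rule s) (use that d(2) Ring(2) in blast)
      show "P i x \<noteq> c x i j LR"
        using leaf_color_neq[of j LR s 0] assms(2) P c by simp
      show "c x i j l \<noteq> h + 1" if "h \<in> {1..p}" for l h
        using leaf_color_neq[of h l s 0] that c by simp
    qed
  qed simp
next
  case Stem
  show ?thesis
  proof (rule that[of "j + 1" LR])
    fix P c d
    assume d: "d \<in> leaf_edges p x i j" "d \<noteq> e" and c: "c x i j = leaf_color LR (j + 1)"
    show "inj_on (H_color P c) d"
    proof (rule H_color_leaf_edge[OF d(1)])
      show "c x i j l \<noteq> h + 1" if "h \<in> {1..p}" "l \<noteq> LR \<or> h \<noteq> j" for l h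
        unfolding c by (rule leaf_color_neq) (use that in auto)
    qed (use d(2) Stem c assms(2) in \<open>simp_all add: leaf_color_proper\<close>)
  qed (use assms(2) in simp)
next
  case (Join l h)
  show ?thesis
  proof (rule that[of "h + 1" l])
    fix P c d
    assume d: "d \<in> leaf_edges p x i j" "d \<noteq> e" and P: "P i x = j + 1" and c: "c x i j = leaf_color l (h + 1)"
    show "inj_on (H_color P c) d"
    proof (rule H_color_leaf_edge[OF d(1)])
      show "P i x \<noteq> c x i j LR"
        \<comment> \<open>If \<open>l\<close> is the root, then \<open>h\<close> differs from
          \<open>j\<close>, so the color \<open>h + 1\<close> does not clash with
          \<open>j + 1\<close> along the stem.\<close>
        using leaf_color_neq[of j LR l "h + 1"] assms(2) P c Join(2) by simp
      show "c x i j l' \<noteq> h' + 1" if "h' \<in> {1..p}" "d = {Leaf x i j l', Clq h'}" for l' h'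
      proof -
        have "l' \<noteq> l \<or> h' \<noteq> h" using that(2) d(2) Join(3) by blast
        then show ?thesis
          unfolding c by (intro leaf_color_neq) (use that(1) in auto)
      qed
    qed (use Join(1) c in \<open>simp add: leaf_color_proper\<close>)
  qed (use Join(1) in simp)
qed

text \<open>Away from level \<open>i\<^sub>0\<close> each connector has the color 2 at exactly one
  end, so conditions remain only at that level. The last hypothesis lets the leaf with the deleted
  edge be checked separately.\<close>

lemma level_color_proper:
  fixes c g i\<^sub>0
  defines "f \<equiv> H_color (level_color i\<^sub>0 g) c"
  assumes "i\<^sub>0 \<le> m"
    and pent: "\<And>d. d \<in> pentagon CA CB CC CD CT \<Longrightarrow> (\<lambda>x. Pent x i\<^sub>0) ` d \<noteq> e \<Longrightarrow> inj_on g d"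
    and CC: "i\<^sub>0 < m \<Longrightarrow> {Pent CC i\<^sub>0, Pent CA (i\<^sub>0 + 1)} \<noteq> e \<Longrightarrow> g CC \<noteq> 2"
    and CA: "i\<^sub>0 > 0 \<Longrightarrow> g CA \<noteq> 2"
    and leaf: "\<And>x i j. (x, i, j) \<in> leaves (k-3) m \<Longrightarrow>
      c x i j = leaf_color LR (j + 1) \<and> (i = i\<^sub>0 \<longrightarrow> g x \<noteq> j + 1) \<or>
      (\<forall>d\<in>leaf_edges (k-3) x i j. d \<noteq> e \<longrightarrow> inj_on f d)"
  shows "\<forall>d\<in>edges (H_graph k m) - {e}. inj_on f d"
proof
  fix d assume d: "d \<in> edges (H_graph k m) - {e}"
  then have "d \<in> edges (H_graph k m)" by simp
  then show "inj_on f d"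
  proof (cases rule: H_graph_edgesE)
    case (Clique h j)
    then show ?thesis by (simp add: f_def inj_on_doubleton)
  next
    case (Pentagon i)
    then obtain d' where d': "d' \<in> pentagon CA CB CC CD CT" "d = (\<lambda>x. Pent x i) ` d'"
      using pentagon_image[of "\<lambda>x. Pent x i"] by auto
    have "inj_on (pent_color s 2) d'" for s
      using d'(1) by (intro pent_color_proper) auto
    moreover have "inj_on g d'" if "i = i\<^sub>0"
      using d d' pent[OF d'(1)] that by blast
    ultimately have "inj_on (level_color i\<^sub>0 g i) d'"
      by (simp add: level_color_def)
    then show ?thesis
      unfolding d'(2) f_def by (intro inj_on_pentagon_image) auto
  next
    case (Connector i)
    have "level_color i\<^sub>0 g i CC \<noteq> level_color i\<^sub>0 g (i + 1) CA"
    proof -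
      consider "i + 1 < i\<^sub>0" | "i + 1 = i\<^sub>0" | "i = i\<^sub>0" | "i > i\<^sub>0" by linarith
      then show ?thesis
        using CC CA d Connector
        by cases (auto simp: level_color_def pent_color_def ring_color_def)
    qed
    then show ?thesis
      unfolding Connector f_def by (simp add: inj_on_doubleton)
  next
    case (Leaf_edge x i j)
    note iff = Leaf_edge(1)[unfolded leaves_iff]
    from leaf[OF Leaf_edge(1)] show ?thesis
    proof (elim disjE conjE)
      assume c: "c x i j = leaf_color LR (j + 1)" "i = i\<^sub>0 \<longrightarrow> g x \<noteq> j + 1"
      \<comment> \<open>Off level \<open>i\<^sub>0\<close> the color 2 sits on \<open>CC\<close>
        below and on \<open>CA\<close> above, and there the leaf for \<open>Clq 1\<close> is
        absent.\<close>
      have "level_color i\<^sub>0 g i x \<noteq> j + 1"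
        using c(2) iff \<open>i\<^sub>0 \<le> m\<close> pent_color_cases[of x CC 2] pent_color_cases[of x CA 2]
        by (auto simp: level_color_def)
      then show ?thesis
        using Leaf_edge(2) c(1) iff unfolding f_def by (intro leaf_color_edge) auto
    qed (use d Leaf_edge(2) in blast)
  qed
qed

lemma H_color_less:
  assumes "k \<ge> 4" "\<And>x. g x < k - 1"
    and "\<And>x i j l. (x, i, j) \<in> leaves (k-3) m \<Longrightarrow> c x i j l < k - 1"
    and "v \<in> verts (H_graph k m)"
  shows "H_color (level_color i\<^sub>0 g) c v < k - 1"
proof (cases v)
  case (Pent x i)
  have "level_color i\<^sub>0 g i x < k - 1"
    using assms(1,2) pent_color_cases[of x CC 2] pent_color_cases[of x CA 2]
    by (auto simp: level_color_def)
  then show ?thesis using Pent by simp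
qed (use assms in auto)

lemma leaf_color_less: "\<gamma> < k - 1 \<Longrightarrow> k \<ge> 4 \<Longrightarrow> leaf_color s \<gamma> l < k - 1"
  using leaf_color_cases[of l s \<gamma>] by auto

lemma pent_color_less: "\<gamma> < k - 1 \<Longrightarrow> k \<ge> 4 \<Longrightarrow> pent_color s \<gamma> x < k - 1"
  using pent_color_cases[of x s \<gamma>] by auto

lemma H_color_standard_less:
  assumes "k \<ge> 4" "\<And>x. g x < k - 1" "v \<in> verts (H_graph k m)"
  shows "H_color (level_color i\<^sub>0 g) (\<lambda>x i j. leaf_color LR (j + 1)) v < k - 1"
proof (rule H_color_less[OF assms(1,2) _ assms(3)])
  fix x i j l assume "(x, i, j) \<in> leaves (k-3) m"
  then show "leaf_color LR (j + 1) l < k - 1"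
    using assms(1) by (intro leaf_color_less) (auto simp: leaves_iff)
qed

text \<open>Without the edge between \<open>q\<^sub>a\<close> and \<open>q\<^sub>b\<close> the vertex \<open>q\<^sub>b\<close> can reuse the color of \<open>q\<^sub>a\<close>, so that
  \<open>b + 1\<close> becomes a third color for the pentagons.\<close>

lemma H_graph_minus_clique_edge_coloring:
  assumes "k \<ge> 4" "a \<in> {1..k-3}" "b \<in> {1..k-3}" "a \<noteq> b"
  shows "\<exists>f. (\<forall>v\<in>verts (H_graph k m). f v < k - 1) \<and>
    (\<forall>d\<in>edges (H_graph k m) - {{Clq a, Clq b}}. inj_on f d)"
proof -
  \<comment> \<open>Within a pentagon only \<open>CC\<close> has the color \<open>b + 1\<close>, now
    absent from the clique. At the leaves of \<open>CC\<close> this color moves from the root to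
    \<open>LZ\<close>, to keep the stem proper.\<close>
  define f where "f v = (case v of Clq h \<Rightarrow> if h = b then a + 1 else h + 1
     | Pent x i \<Rightarrow> pent_color CC (b + 1) x
     | Leaf x i j l \<Rightarrow> leaf_color (if x = CC then LZ else LR) (b + 1) l)" for v
  have f_simps: "f (Clq h) = (if h = b then a + 1 else h + 1)" "f (Pent x i) = pent_color CC (b + 1) x"
    "f (Leaf x i j l) = leaf_color (if x = CC then LZ else LR) (b + 1) l" for h x i j l
    by (simp_all add: f_def)
  have "f v < k - 1" if "v \<in> verts (H_graph k m)" for v
    using that assms pent_color_less[of "b + 1" k] leaf_color_less[of "b + 1" k]
    by (cases v) (auto simp: f_simps)
  moreover have "inj_on f d" if "d \<in> edges (H_graph k m)" "d \<noteq> {Clq a, Clq b}" for d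
    using that(1)
  proof (cases rule: H_graph_edgesE)
    case (Clique h j)
    then have "f (Clq h) \<noteq> f (Clq j)"
      using that(2) by (auto simp: f_simps doubleton_eq_iff)
    then show ?thesis
      unfolding Clique(4) inj_on_doubleton by simp
  next
    case (Pentagon i)
    then obtain d' where d': "d' \<in> pentagon CA CB CC CD CT" "d = (\<lambda>x. Pent x i) ` d'"
      using pentagon_image[of "\<lambda>x. Pent x i"] by auto
    have "inj_on (pent_color CC (b + 1)) d'"
      using d'(1) assms(3) by (intro pent_color_proper) auto
    then show ?thesis
      unfolding d'(2) by (intro inj_on_pentagon_image) (auto simp: f_simps)
  next
    case (Connector i)
    then show ?thesis
      using assms(3) pent_color_cases[of CA CC "b + 1"] pent_color_cases[of CC CC "b + 1"]
      by (auto simp: f_simps inj_on_doubleton)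
  next
    case (Leaf_edge x i j)
    let ?s = "if x = CC then LZ else LR"
    from Leaf_edge(2) show ?thesis
    proof (cases rule: leaf_edges_cases)
      case (Ring d')
      have "inj_on (leaf_color ?s (b + 1)) d'"
        using Ring(1) assms(3) by (intro leaf_color_proper) auto
      then show ?thesis
        unfolding Ring(2) by (intro inj_on_pentagon_image) (auto simp: f_simps)
    next
      case Stem
      have "pent_color CC (b + 1) x \<noteq> leaf_color ?s (b + 1) LR"
        using assms(3) pent_color_cases[of x CC "b + 1"] leaf_color_cases[of LR ?s "b + 1"]
        by (cases "x = CC") auto
      then show ?thesis
        unfolding Stem by (simp add: f_simps inj_on_doubleton)
    next
      case (Join l h)
      have "leaf_color ?s (b + 1) l \<noteq> f (Clq h)"
        using Join(1) assms leaf_color_cases[of l ?s "b + 1"] by (auto simp: f_simps)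
      then show ?thesis
        unfolding Join(3) inj_on_doubleton by (simp only: f_simps)  simp
    qed
  qed
  ultimately show ?thesis by blast
qed

text \<open>The level of the deleted edge serves as \<open>i\<^sub>0\<close>, except for clique
  edges, where the clique itself is recolored.\<close>

lemma H_graph_minus_edge_coloring:
  assumes "k \<ge> 4" "e \<in> edges (H_graph k m)"
  shows "\<exists>f. (\<forall>v\<in>verts (H_graph k m). f v < k - 1) \<and>
    (\<forall>d\<in>edges (H_graph k m) - {e}. inj_on f d)"
  using assms(2)
proof (cases rule: H_graph_edgesE)
  case (Clique h j)
  then show ?thesis using H_graph_minus_clique_edge_coloring assms(1) by simp
next
  case (Pentagon i)
  obtain e' where e': "e' \<in> pentagon CA CB CC CD CT" "e = (\<lambda>x. Pent x i) ` e'"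
    using Pentagon(2) pentagon_image[of "\<lambda>x. Pent x i"] by auto
  obtain s where s: "\<And>d. d \<in> pentagon CA CB CC CD CT - {e'} \<Longrightarrow> inj_on (pent_color s 0) d"
    using pent_color_proper_off e'(1) by blast
  have s2: "pent_color s 0 x < 2" for x
    using pent_color_cases[of x s 0] by auto
  \<comment> \<open>The pentagon that lost an edge is a path, so 0 and 1 suffice there and no leaf
    objects.\<close>
  let ?f = "H_color (level_color i (pent_color s 0)) (\<lambda>x i j. leaf_color LR (j + 1))"
  have "\<forall>d\<in>edges (H_graph k m) - {e}. inj_on ?f d"
  proof (rule level_color_proper)
    show "inj_on (pent_color s 0) d"
      if "d \<in> pentagon CA CB CC CD CT" "(\<lambda>x. Pent x i) ` d \<noteq> e" for d
      using that s e' by blast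
    show "leaf_color LR (j + 1) = leaf_color LR (j + 1) \<and> (i' = i \<longrightarrow> pent_color s 0 x \<noteq> j + 1) \<or>
      (\<forall>d\<in>leaf_edges (k - 3) x i' j. d \<noteq> e \<longrightarrow> inj_on ?f d)"
      if "(x, i', j) \<in> leaves (k - 3) m" for x i' j
      using that s2[of x] by (auto simp: leaves_iff)
  qed (use s2[of CC] s2[of CA] Pentagon(1) in auto)
  moreover have "?f v < k - 1" if "v \<in> verts (H_graph k m)" for v
    using assms(1) that by (intro H_color_standard_less pent_color_less) auto
  ultimately show ?thesis by blast
next
  case (Connector i)
  \<comment> \<open>Both ends of the deleted connector have the color 2, and this is the only
    clash.\<close>
  let ?f = "H_color (level_color i (pent_color CC 2)) (\<lambda>x i j. leaf_color LR (j + 1))"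
  have "\<forall>d\<in>edges (H_graph k m) - {e}. inj_on ?f d"
  proof (rule level_color_proper)
    show "leaf_color LR (j + 1) = leaf_color LR (j + 1) \<and> (i' = i \<longrightarrow> pent_color CC 2 x \<noteq> j + 1) \<or>
      (\<forall>d\<in>leaf_edges (k - 3) x i' j. d \<noteq> e \<longrightarrow> inj_on ?f d)"
      if "(x, i', j) \<in> leaves (k - 3) m" for x i' j
      using that Connector(1) pent_color_cases[of x CC 2] by (auto simp: leaves_iff)
    show "pent_color CC 2 CA \<noteq> 2"
      using pent_color_cases[of CA CC 2] by auto
  qed (use Connector pent_color_proper in auto)
  moreover have "?f v < k - 1" if "v \<in> verts (H_graph k m)" for v
    using assms(1) that by (intro H_color_standard_less pent_color_less) auto
  ultimately show ?thesis by blast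
next
  case (Leaf_edge x i j)
  then have iff: "i \<le> m" "j \<in> {1..k-3}" "x = CA \<and> i > 0 \<longrightarrow> j \<noteq> 1" "x = CC \<and> i < m \<longrightarrow> j \<noteq> 1"
    by (auto simp: leaves_iff)
  obtain s \<gamma> where s: "\<gamma> < k - 3 + 2" "\<And>P c d. d \<in> leaf_edges (k-3) x i j \<Longrightarrow> d \<noteq> e \<Longrightarrow>
      P i x = j + 1 \<Longrightarrow> c x i j = leaf_color s \<gamma> \<Longrightarrow> inj_on (H_color P c) d"
    by (rule leaf_color_edge_off[OF Leaf_edge(2) iff(2)]) (rule that)
  define c where "c x' i' j' = (if (x', i', j') = (x, i, j) then leaf_color s \<gamma> else leaf_color LR (j' + 1))"
    for x' i' j'
  \<comment> \<open>The damaged leaf permits \<open>j + 1\<close> at \<open>x\<close>. By the choice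
    of the attached leaves this is not the color 2 if \<open>x\<close> is an end of a
    connector.\<close>
  define g where "g = pent_color x (j + 1)"
  have g: "x' = x \<and> g x' = j + 1 \<or> x' \<noteq> x \<and> g x' < 2" for x'
    unfolding g_def by (rule pent_color_cases)
  let ?f = "H_color (level_color i g) c"
  have "\<forall>d\<in>edges (H_graph k m) - {e}. inj_on ?f d"
  proof (rule level_color_proper)
    show "inj_on g d" if "d \<in> pentagon CA CB CC CD CT" for d
      using that pent_color_proper[of "j + 1" d x] iff(2) by (auto simp: g_def)
    show "g CC \<noteq> 2" if "i < m"
      using that g[of CC] iff by auto
    show "g CA \<noteq> 2" if "i > 0"
      using that g[of CA] iff by auto
    show "c x' i' j' = leaf_color LR (j' + 1) \<and> (i' = i \<longrightarrow> g x' \<noteq> j' + 1) \<or>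
      (\<forall>d\<in>leaf_edges (k - 3) x' i' j'. d \<noteq> e \<longrightarrow> inj_on ?f d)"
      if "(x', i', j') \<in> leaves (k - 3) m" for x' i' j'
    proof (cases "(x', i', j') = (x, i, j)")
      case True
      moreover have "level_color i g i x = j + 1"
        using g[of x] by (simp add: level_color_def)
      ultimately show ?thesis
        using s(2) by (simp add: c_def)
    next
      case False
      then show ?thesis
        using that g[of x'] by (auto simp: c_def leaves_iff)
    qed
  qed (use iff in auto)
  moreover have "?f v < k - 1" if "v \<in> verts (H_graph k m)" for v
  proof (rule H_color_less[OF assms(1) _ _ that])
    show "g x' < k - 1" for x'
      using assms(1) iff(2) unfolding g_def by (intro pent_color_less) auto
    show "c x' i' j' l < k - 1" if "(x', i', j') \<in> leaves (k - 3) m" for x' i' j' l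
    proof -
      have "leaf_color s \<gamma> l < k - 1" "leaf_color LR (j' + 1) l < k - 1"
        using that assms(1) s(1) unfolding leaves_iff by (intro leaf_color_less; linarith)+
      then show ?thesis by (simp add: c_def)
    qed
  qed
  ultimately show ?thesis by blast
qed

section \<open>Criticality\<close>

lemma H_graph_not_colorable:
  assumes "k \<ge> 4"
  shows "\<not> colorable (k - 1) (H_graph k m)"
proof
  let ?p = "k - 3"
  assume "colorable (k - 1) (H_graph k m)"
  then obtain f where lt: "\<And>v. v \<in> verts (H_graph k m) \<Longrightarrow> f v < k - 1"
    and ne: "\<And>x y. {x, y} \<in> edges (H_graph k m) \<Longrightarrow> f x \<noteq> f y"
    unfolding colorable_def by blast
  let ?Q = "(\<lambda>j. f (Clq j)) ` {1..?p}"
  have "inj_on (\<lambda>j. f (Clq j)) {1..?p}"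
  proof (rule inj_onI, rule ccontr)
    fix h j assume "h \<in> {1..?p}" "j \<in> {1..?p}" "f (Clq h) = f (Clq j)" "h \<noteq> j"
    then show False
      using ne[OF H_graph_edgesI(1)] by blast
  qed
  then have "card ?Q = ?p" by (simp add: card_image)
  moreover have "?Q \<subseteq> {..<k - 1}" using lt by auto
  \<comment> \<open>The clique uses k - 3 of the k - 1 colors.\<close>
  ultimately have "card ({..<k - 1} - ?Q) = 2"
    using assms by (simp add: card_Diff_subset)
  then obtain \<alpha> \<beta> where free: "{..<k - 1} - ?Q = {\<alpha>, \<beta>}"
    by (auto simp: card_2_iff)
  have free_iff: "f v \<in> {\<alpha>, \<beta>} \<longleftrightarrow> f v \<notin> ?Q" if "v \<in> verts (H_graph k m)" for v
    using lt[OF that] unfolding free[symmetric] by blast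
  have root: "f (Leaf x i j LR) = f (Clq j)" if L: "(x, i, j) \<in> leaves ?p m" for x i j
  proof -
    have E: "f u \<noteq> f v" if "{u, v} \<in> leaf_edges ?p x i j" for u v
      using ne[OF H_graph_edgesI(4)[OF L that]] .
    have join: "f (Leaf x i j l) \<in> {\<alpha>, \<beta>}" if "l \<noteq> LR" for l
    proof -
      have "f (Leaf x i j l) \<noteq> f (Clq h)" if "h \<in> {1..?p}" for h
        using that \<open>l \<noteq> LR\<close> by (intro E) (cases l; auto simp: leaf_edges_def)
      then have "f (Leaf x i j l) \<notin> ?Q" by blast
      then show ?thesis
        using L free_iff[of "Leaf x i j l"] by simp
    qed
    have "f (Leaf x i j LR) \<noteq> f (Leaf x i j LU)" "f (Leaf x i j LU) \<noteq> f (Leaf x i j LV)"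
      "f (Leaf x i j LV) \<noteq> f (Leaf x i j LW)" "f (Leaf x i j LW) \<noteq> f (Leaf x i j LZ)"
      "f (Leaf x i j LZ) \<noteq> f (Leaf x i j LR)"
      by (intro E; simp add: leaf_edges_def pentagon_def)+
    \<comment> \<open>The path u, v, w, z alternates between \<alpha> and \<beta>, so its ends show
      both colors and the root, adjacent to both ends, has neither.\<close>
    then have "f (Leaf x i j LR) \<notin> {\<alpha>, \<beta>}"
      using join[of LU] join[of LV] join[of LW] join[of LZ] by auto
    then have "f (Leaf x i j LR) \<in> ?Q"
      using L free_iff[of "Leaf x i j LR"] by simp
    then obtain h where h: "h \<in> {1..?p}" "f (Leaf x i j LR) = f (Clq h)" by blast
    have "h = j"
    proof (rule ccontr)
      assume "h \<noteq> j"
      then have "f (Leaf x i j LR) \<noteq> f (Clq h)"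
        using h(1) by (intro E) (auto simp: leaf_edges_def)
      then show False using h(2) by simp
    qed
    then show ?thesis using h by simp
  qed
  have stem: "f (Pent x i) \<noteq> f (Clq j)" if L: "(x, i, j) \<in> leaves ?p m" for x i j
  proof -
    have "{Pent x i, Leaf x i j LR} \<in> edges (H_graph k m)"
      by (rule H_graph_edgesI(4)[OF L]) (simp add: leaf_edges_def)
    then show ?thesis using ne root[OF L] by metis
  qed
  \<comment> \<open>The attached leaves exclude every clique color except possibly that of
    \<open>Clq 1\<close>; the second premise excludes it or says that its leaf is attached.\<close>
  have two: "f (Pent x i) \<in> {\<alpha>, \<beta>}"
    if "i \<le> m" "f (Pent x i) \<noteq> f (Clq 1) \<or> (x = CA \<longrightarrow> i = 0) \<and> (x = CC \<longrightarrow> i = m)" for x i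
  proof -
    have "f (Pent x i) \<noteq> f (Clq j)" if "j \<in> {1..?p}" for j
      using \<open>i \<le> m\<close> \<open>_ \<or> _\<close> that stem[of x i j] by (cases "j = 1") (auto simp: leaves_iff)
    then have "f (Pent x i) \<notin> ?Q" by blast
    then show ?thesis
      using that(1) free_iff[of "Pent x i"] by simp
  qed
  have P: "f (Pent CA i) \<noteq> f (Pent CB i)" "f (Pent CB i) \<noteq> f (Pent CC i)"
    "f (Pent CC i) \<noteq> f (Pent CD i)" "f (Pent CD i) \<noteq> f (Pent CT i)"
    "f (Pent CT i) \<noteq> f (Pent CA i)" if "i \<le> m" for i
    using that by (intro ne H_graph_edgesI(2)[of i]; simp add: pentagon_def)+
  \<comment> \<open>Otherwise the 5-cycle would be colored with \<alpha> and \<beta> alone.\<close>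
  have odd: "f (Pent CC i) \<notin> {\<alpha>, \<beta>}" if "i \<le> m" "f (Pent CA i) \<in> {\<alpha>, \<beta>}" for i
    using P[OF that(1)] that(2) two[of i CB] two[of i CD] two[of i CT] that(1) by auto
  have "f (Pent CA i) \<in> {\<alpha>, \<beta>}" if "i \<le> m" for i
    using that
  proof (induction i)
    case 0
    then show ?case by (intro two) auto
  next
    case (Suc i)
    then have "f (Pent CC i) = f (Clq 1)"
      using odd[of i] two[of i CC] by fastforce
    moreover have "f (Pent CC i) \<noteq> f (Pent CA (Suc i))"
      using ne H_graph_edgesI(3)[of i m k] Suc.prems by simp
    ultimately show ?case
      using Suc.prems by (intro two) auto
  qed
  \<comment> \<open>At the last level \<open>CC\<close> has the leaf for \<open>Clq 1\<close> too,
    so the propagation ends in a contradiction.\<close>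
  then show False using odd[of m] two[of m CC] by simp
qed

lemma critical_H_graph:
  assumes "k \<ge> 4"
  shows "critical k (H_graph k m)"
proof (rule critical_if_edge_critical)
  show "edges (H_graph k m) \<noteq> {}"
    using H_graph_vert_in_edge[OF assms, of "Pent CA 0" m] by auto
qed (use assms simple_H_graph H_graph_not_colorable H_graph_vert_in_edge
      H_graph_minus_edge_coloring in auto)

section \<open>Chords\<close>

definition leaf_set :: "corner \<times> nat \<times> nat \<Rightarrow> hvert set" where
  "leaf_set = (\<lambda>(x, i, j). range (Leaf x i j))"

definition visited :: "nat \<Rightarrow> nat \<Rightarrow> hvert list \<Rightarrow> (corner \<times> nat \<times> nat) set" where
  "visited k m c = {t \<in> leaves (k - 3) m. set c \<inter> leaf_set t \<noteq> {}}"

text \<open>The levels whose pentagon is left by the cycle through the stem of a leaf.\<close>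

definition terminal :: "hvert list \<Rightarrow> nat set" where
  "terminal c = {i. \<exists>x j. {Pent x i, Leaf x i j LR} \<in> cycle_edges c}"

lemma leaf_set_iff: "v \<in> leaf_set (x, i, j) \<longleftrightarrow> (\<exists>l. v = Leaf x i j l)"
  by (auto simp: leaf_set_def)

lemma edge_Leaf_leaves: "{Leaf x i j l, y} \<in> edges (H_graph k m) \<Longrightarrow> (x, i, j) \<in> leaves (k - 3) m"
  using simple_H_graph[of k m] unfolding simple_graph_def by force

lemma visited_if_edge:
  assumes "{Leaf x i j l, y} \<in> edges (H_graph k m)" "Leaf x i j l \<in> set c"
  shows "(x, i, j) \<in> visited k m c"
  using edge_Leaf_leaves[OF assms(1)] assms(2) by (auto simp: visited_def leaf_set_def)

text \<open>The cycle crosses the border of a visited leaf at least twice, and only one of the edges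
  there does not end in the clique.\<close>

lemma visited_clique_edge:
  assumes c: "is_cycle (H_graph k m) c" and t: "t \<in> visited k m c" and "\<not> set c \<subseteq> leaf_set t"
  shows "\<exists>v\<in>leaf_set t. \<exists>h\<in>{1..k-3}. {v, Clq h} \<in> cycle_edges c"
proof -
  obtain x i j where tx: "t = (x, i, j)" by (cases t)
  have cyc: "3 \<le> length c" "distinct c" "cycle_edges c \<subseteq> edges (H_graph k m)"
    using c unfolding is_cycle_def by auto
  obtain a where a: "a \<in> set c" "a \<in> leaf_set t"
    using t unfolding visited_def by blast
  obtain u v u' v' where uv: "u \<in> leaf_set t" "v \<notin> leaf_set t" "u' \<in> leaf_set t" "v' \<notin> leaf_set t"
    "{u, v} \<in> cycle_edges c" "{u', v'} \<in> cycle_edges c" "{u, v} \<noteq> {u', v'}"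
    by (rule cycle_edges_crossing[OF cyc(1,2) a assms(3)])
  have cross: "(\<exists>h\<in>{1..k-3}. v = Clq h) \<or> u = Leaf x i j LR \<and> v = Pent x i"
    if uv: "u \<in> leaf_set t" "v \<notin> leaf_set t" "{u, v} \<in> cycle_edges c" for u v
  proof -
    obtain l where u: "u = Leaf x i j l"
      using uv(1) unfolding tx leaf_set_iff by blast
    then have "{Leaf x i j l, v} \<in> edges (H_graph k m)"
      using uv(3) cyc(3) by blast
    from edge_LeafD[OF this] show ?thesis
      using uv(2) u unfolding tx leaf_set_iff by blast
  qed
  show ?thesis
    using cross[OF uv(1,2,5)] cross[OF uv(3,4,6)] uv by metis
qed

lemma finite_visited [simp]: "finite (visited k m c)"
  unfolding visited_def by simp

text \<open>Each visited leaf is charged to a cycle edge between it and the clique. Such an edge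
  determines the leaf, and a cycle has at most two edges at each clique vertex. A cycle inside a
  single leaf visits no other.\<close>

lemma card_visited:
  assumes k: "k \<ge> 4" and c: "is_cycle (H_graph k m) c"
  shows "card (visited k m c) \<le> 2 * (k - 3)"
proof (cases "\<exists>t. set c \<subseteq> leaf_set t")
  case True
  then obtain t where "set c \<subseteq> leaf_set t" by blast
  then have "visited k m c \<subseteq> {t}"
    unfolding visited_def leaf_set_def by (cases t) fastforce
  then have "card (visited k m c) \<le> card {t}"
    by (intro card_mono) auto
  then show ?thesis using k by simp
next
  case False
  let ?E = "{e \<in> cycle_edges c. e \<inter> Clq ` {1..k-3} \<noteq> {}}"
  have "\<exists>e. e \<in> cycle_edges c \<and> (\<exists>v\<in>leaf_set t. \<exists>h\<in>{1..k-3}. e = {v, Clq h})" if "t \<in> visited k m c" for t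
  proof -
    have "\<not> set c \<subseteq> leaf_set t" using False by blast
    from visited_clique_edge[OF c that this] show ?thesis by blast
  qed
  then obtain F where F: "\<And>t. t \<in> visited k m c \<Longrightarrow> F t \<in> cycle_edges c"
    "\<And>t. t \<in> visited k m c \<Longrightarrow> \<exists>v\<in>leaf_set t. \<exists>h\<in>{1..k-3}. F t = {v, Clq h}"
    by metis
  have "inj_on F (visited k m c)"
  proof (rule inj_onI)
    fix t t' assume "t \<in> visited k m c" "t' \<in> visited k m c" "F t = F t'"
    moreover from this obtain v h where "v \<in> leaf_set t" "F t = {v, Clq h}"
      using F(2) by blast
    moreover from calculation obtain v' h' where "v' \<in> leaf_set t'" "F t' = {v', Clq h'}"
      using F(2) by blast
    ultimately have "v \<in> leaf_set t" "v' \<in> leaf_set t'" "{v, Clq h} = {v', Clq h'}"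
      by simp_all
    then show "t = t'"
      by (cases t; cases t') (auto simp: leaf_set_iff doubleton_eq_iff)
  qed
  moreover have "F ` visited k m c \<subseteq> ?E"
    using F by fastforce
  ultimately have "card (visited k m c) \<le> card ?E"
    by (intro card_inj_on_le) auto
  also have "\<dots> \<le> 2 * card (Clq ` {1..k-3})"
    using c by (intro card_cycle_edges_meeting) (auto simp: is_cycle_def)
  also have "card (Clq ` {1..k-3}) \<le> k - 3"
    using card_image_le[of "{1..k-3}" Clq] by simp
  finally show ?thesis by simp
qed

section \<open>Terminal levels and chords at the pentagons\<close>

lemma terminal_subset:
  assumes "is_cycle (H_graph k m) c"
  shows "terminal c \<subseteq> (\<lambda>(x, i, j). i) ` visited k m c"
proof
  fix i assume "i \<in> terminal c"
  then obtain x j where e: "{Pent x i, Leaf x i j LR} \<in> cycle_edges c"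
    unfolding terminal_def by blast
  then have "{Leaf x i j LR, Pent x i} \<in> edges (H_graph k m)"
    using assms unfolding is_cycle_def insert_commute[of "Leaf x i j LR"] by blast
  moreover have "Leaf x i j LR \<in> set c"
    using cycle_edges_subset[OF e] by simp
  ultimately have "(x, i, j) \<in> visited k m c"
    by (rule visited_if_edge)
  then show "i \<in> (\<lambda>(x, i, j). i) ` visited k m c"
    by (rule rev_image_eqI) simp
qed

lemma terminal_bound:
  assumes "k \<ge> 4" "is_cycle (H_graph k m) c"
  shows "finite (terminal c)" "card (terminal c) \<le> 2 * (k - 3)"
proof -
  show "finite (terminal c)"
    using finite_subset[OF terminal_subset[OF assms(2)]] by simp
  have "card (terminal c) \<le> card (visited k m c)"
    by (rule surj_card_le[OF finite_visited terminal_subset[OF assms(2)]])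
  then show "card (terminal c) \<le> 2 * (k - 3)"
    using card_visited[OF assms] by simp
qed

text \<open>Without stems, \<open>CB\<close>, \<open>CD\<close> and \<open>CT\<close> have just
  their two pentagon neighbors left, as does \<open>CC\<close> once its connector is excluded; a
  vertex on the cycle must use both.\<close>

lemma nonterminal_edges:
  assumes c: "is_cycle (H_graph k m) c" and i: "i \<notin> terminal c"
  shows "Pent CB i \<in> set c \<Longrightarrow> {Pent CB i, Pent CA i} \<in> cycle_edges c \<and> {Pent CB i, Pent CC i} \<in> cycle_edges c"
    "Pent CD i \<in> set c \<Longrightarrow> {Pent CD i, Pent CC i} \<in> cycle_edges c \<and> {Pent CD i, Pent CT i} \<in> cycle_edges c"
    "Pent CT i \<in> set c \<Longrightarrow> {Pent CT i, Pent CD i} \<in> cycle_edges c \<and> {Pent CT i, Pent CA i} \<in> cycle_edges c"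
    "Pent CC i \<in> set c \<Longrightarrow> {Pent CC i, Pent CA (i + 1)} \<notin> cycle_edges c \<Longrightarrow>
       {Pent CC i, Pent CB i} \<in> cycle_edges c \<and> {Pent CC i, Pent CD i} \<in> cycle_edges c"
proof -
  have cyc: "3 \<le> length c" "distinct c" "cycle_edges c \<subseteq> edges (H_graph k m)"
    using c unfolding is_cycle_def by auto
  have nbr: "(\<exists>x'. y = Pent x' i \<and> {x, x'} \<in> pentagon CA CB CC CD CT) \<or>
    (x = CC \<and> y = Pent CA (i + 1)) \<or> (x = CA \<and> i > 0 \<and> y = Pent CC (i - 1))"
    if e: "{Pent x i, y} \<in> cycle_edges c" for x y
  proof -
    have "\<nexists>j. y = Leaf x i j LR"
      using e i unfolding terminal_def by blast
    then show ?thesis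
      using edge_PentD[of x i y k m] e cyc(3) by blast
  qed
  have both: "{Pent x i, y1} \<in> cycle_edges c \<and> {Pent x i, y2} \<in> cycle_edges c"
    if "Pent x i \<in> set c" "\<And>y. {Pent x i, y} \<in> cycle_edges c \<Longrightarrow> y = y1 \<or> y = y2" for x y1 y2
    using cycle_edges_two[OF cyc(1,2) that(1)] that(2) by metis
  have pent: "{CB, x} \<in> pentagon CA CB CC CD CT \<longleftrightarrow> x = CA \<or> x = CC"
    "{CC, x} \<in> pentagon CA CB CC CD CT \<longleftrightarrow> x = CB \<or> x = CD"
    "{CD, x} \<in> pentagon CA CB CC CD CT \<longleftrightarrow> x = CC \<or> x = CT"
    "{CT, x} \<in> pentagon CA CB CC CD CT \<longleftrightarrow> x = CD \<or> x = CA" for x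
    by (cases x; simp add: pentagon_def doubleton_eq_iff)+
  show "Pent CB i \<in> set c \<Longrightarrow> {Pent CB i, Pent CA i} \<in> cycle_edges c \<and> {Pent CB i, Pent CC i} \<in> cycle_edges c"
    by (rule both) (use nbr[of CB] pent(1) in blast)+
  show "Pent CD i \<in> set c \<Longrightarrow> {Pent CD i, Pent CC i} \<in> cycle_edges c \<and> {Pent CD i, Pent CT i} \<in> cycle_edges c"
    by (rule both) (use nbr[of CD] pent(3) in blast)+
  show "Pent CT i \<in> set c \<Longrightarrow> {Pent CT i, Pent CD i} \<in> cycle_edges c \<and> {Pent CT i, Pent CA i} \<in> cycle_edges c"
    by (rule both) (use nbr[of CT] pent(4) in blast)+
  show "Pent CC i \<in> set c \<Longrightarrow> {Pent CC i, Pent CA (i + 1)} \<notin> cycle_edges c \<Longrightarrow>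
       {Pent CC i, Pent CB i} \<in> cycle_edges c \<and> {Pent CC i, Pent CD i} \<in> cycle_edges c"
    by (rule both) (use nbr[of CC] pent(2) in blast)+
qed

text \<open>Each edge of the pentagon has an end among \<open>CB\<close>, \<open>CD\<close>,
  \<open>CT\<close>. At a nonterminal level such an end, if on the cycle, has both its pentagon
  edges in the cycle.\<close>

lemma pentagon_chord_terminal:
  assumes c: "is_cycle (H_graph k m) c" and d: "d \<in> chords (H_graph k m) c"
    and p: "d \<in> pentagon (Pent CA i) (Pent CB i) (Pent CC i) (Pent CD i) (Pent CT i)"
  shows "i \<in> terminal c"
proof (rule ccontr)
  assume "i \<notin> terminal c"
  note n = nonterminal_edges(1-3)[OF c this]
  show False
    using p chordsD(2,3)[OF d] n unfolding pentagon_def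
    by (elim insertE emptyE) (auto simp: insert_commute)
qed

text \<open>If the pentagon of \<open>c\<^sub>i\<close> is not terminal and the connector is missing in the cycle, then the cycle
  runs around the whole pentagon and cannot leave it.\<close>

lemma connector_chord_terminal:
  assumes c: "is_cycle (H_graph k m) c" and d: "{Pent CC i, Pent CA (i + 1)} \<in> chords (H_graph k m) c"
  shows "i \<in> terminal c"
proof (rule ccontr)
  assume i: "i \<notin> terminal c"
  note n = nonterminal_edges[OF c this]
  have cyc: "3 \<le> length c" "distinct c" "cycle_edges c \<subseteq> edges (H_graph k m)"
    using c unfolding is_cycle_def by auto
  note ch = chordsD[OF d]
  \<comment> \<open>As an end of a chord, \<open>Pent CC i\<close> is on the cycle; from there the
    cycle edges are forced around the pentagon.\<close>
  have C: "{Pent CC i, Pent CB i} \<in> cycle_edges c" "{Pent CC i, Pent CD i} \<in> cycle_edges c"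
    using n(4) ch(2,3) by simp_all
  have B: "{Pent CB i, Pent CA i} \<in> cycle_edges c"
    using n(1) cycle_edges_subset[OF C(1)] by simp
  have D: "{Pent CD i, Pent CT i} \<in> cycle_edges c"
    using n(2) cycle_edges_subset[OF C(2)] by simp
  have T: "{Pent CT i, Pent CA i} \<in> cycle_edges c"
    using n(3) cycle_edges_subset[OF D] by simp
  \<comment> \<open>The other end of the chord lies outside the pentagon, so some cycle edge must
    leave the pentagon.\<close>
  have "\<not> set c \<subseteq> range (\<lambda>x. Pent x i)"
    using ch(2) by auto
  moreover have "Pent CC i \<in> set c" "Pent CC i \<in> range (\<lambda>x. Pent x i)"
    using ch(2) by auto
  ultimately obtain u v where uv: "u \<in> range (\<lambda>x. Pent x i)" "v \<notin> range (\<lambda>x. Pent x i)" "{u, v} \<in> cycle_edges c"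
    by (elim cycle_edges_crossing[OF cyc(1,2)])
  \<comment> \<open>A vertex with two known cycle edges has no third one; all five pentagon vertices
    are already saturated.\<close>
  have deg: "y = a \<or> y = b"
    if "{w, a} \<in> cycle_edges c" "{w, b} \<in> cycle_edges c" "a \<noteq> b" "{w, y} \<in> cycle_edges c" for w a b y
  proof (rule ccontr)
    assume y: "\<not> (y = a \<or> y = b)"
    have "card {{w, a}, {w, b}, {w, y}} \<le> card {e \<in> cycle_edges c. w \<in> e}"
      by (rule card_mono) (use that in auto)
    then have "card {{w, a}, {w, b}, {w, y}} \<le> 2"
      using card_cycle_edges_at[OF cyc(2), of w] by linarith
    moreover have "{w, a} \<noteq> {w, b}" "{w, a} \<noteq> {w, y}" "{w, b} \<noteq> {w, y}"
      using y that(3) unfolding doubleton_eq_iff by blast+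
    then have "card {{w, a}, {w, b}, {w, y}} = 3"
      by simp
    ultimately show False by simp
  qed
  obtain x where x: "u = Pent x i" using uv(1) by blast
  have sym: "{b, a} \<in> cycle_edges c" if "{a, b} \<in> cycle_edges c" for a b
    using that by (simp add: insert_commute)
  have v: "{Pent x i, v} \<in> cycle_edges c" using uv(3) x by simp
  have "v \<in> {Pent CA i, Pent CB i, Pent CC i, Pent CD i, Pent CT i}"
  proof (cases x)
    case CA
    then show ?thesis
      using deg[OF sym[OF B] sym[OF T], of v] v by auto
  next
    case CB
    then show ?thesis
      using deg[OF B sym[OF C(1)], of v] v by auto
  next
    case CC
    then show ?thesis
      using deg[OF C, of v] v by auto
  next
    case CD
    then show ?thesis
      using deg[OF sym[OF C(2)] D, of v] v by auto
  next
    case CT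
    then show ?thesis
      using deg[OF sym[OF D] T, of v] v by auto
  qed
  then show False using uv(2) by blast
qed

section \<open>Counting the chords\<close>

lemma card_pentagon_le: "card (pentagon a b c d t) \<le> 5"
  using card_length[of "[{a, b}, {b, c}, {c, d}, {d, t}, {t, a}]"] by (simp add: pentagon_def)

text \<open>Every chord lies in the clique, touches a visited leaf, or belongs to a terminal level.
  The set of leaf-clique pairs overcounts, since it also pairs a root with the clique vertex it is
  not joined to; only its size matters.\<close>

lemma chords_subset:
  assumes c: "is_cycle (H_graph k m) c"
  shows "chords (H_graph k m) c \<subseteq>
    {A. A \<subseteq> Clq ` {1..k-3} \<and> card A = 2} \<union>
    (\<lambda>(((x, i, j), l), h). {Leaf x i j l, Clq h}) ` ((visited k m c \<times> UNIV) \<times> {1..k-3}) \<union>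
    (\<Union>(x, i, j)\<in>visited k m c. insert {Pent x i, Leaf x i j LR}
       (pentagon (Leaf x i j LR) (Leaf x i j LU) (Leaf x i j LV) (Leaf x i j LW) (Leaf x i j LZ))) \<union>
    (\<Union>i\<in>terminal c. insert {Pent CC i, Pent CA (i + 1)}
       (pentagon (Pent CA i) (Pent CB i) (Pent CC i) (Pent CD i) (Pent CT i)))"
    (is "_ \<subseteq> ?Q \<union> ?J \<union> ?L \<union> ?P")
proof
  fix d assume d: "d \<in> chords (H_graph k m) c"
  note ch = chordsD[OF d]
  from ch(1) show "d \<in> ?Q \<union> ?J \<union> ?L \<union> ?P"
  proof (cases rule: H_graph_edgesE)
    case (Clique h j)
    then have "d \<in> ?Q" by auto
    then show ?thesis by blast
  next
    case (Pentagon i)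
    then have "d \<in> ?P"
      using pentagon_chord_terminal[OF c d] by blast
    then show ?thesis by blast
  next
    case (Connector i)
    then have "d \<in> ?P"
      using connector_chord_terminal[OF c] d by blast
    then show ?thesis by blast
  next
    case (Leaf_edge x i j)
    have vis: "(x, i, j) \<in> visited k m c" if "Leaf x i j l \<in> d" for l
      using that ch(2) Leaf_edge(1) unfolding visited_def leaf_set_def by auto
    from Leaf_edge(2) show ?thesis
    proof (cases rule: leaf_edges_cases)
      case (Ring d')
      then have "d' \<noteq> {}" unfolding pentagon_def by auto
      then have "(x, i, j) \<in> visited k m c" using vis Ring(2) by blast
      moreover have "d \<in> pentagon (Leaf x i j LR) (Leaf x i j LU) (Leaf x i j LV) (Leaf x i j LW) (Leaf x i j LZ)"
        unfolding pentagon_image Ring(2) using Ring(1) by (rule imageI)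
      ultimately have "d \<in> ?L" by blast
      then show ?thesis by blast
    next
      case Stem
      then have "(x, i, j) \<in> visited k m c" using vis by blast
      then have "d \<in> ?L" using Stem by blast
      then show ?thesis by blast
    next
      case (Join l h)
      then have "(x, i, j) \<in> visited k m c" using vis by blast
      then have "d \<in> ?J"
        using Join(1,3) by (intro image_eqI[of _ _ "(((x, i, j), l), h)"]) auto
      then show ?thesis by blast
    qed
  qed
qed

text \<open>Serves both for leaves, a ring with its stem, and for terminal levels, a pentagon with
  its connector.\<close>

lemma card_UN_insert_pentagon_le:
  assumes "finite I"
  shows "card (\<Union>t\<in>I. insert (f t) (pentagon (a t) (b t) (c t) (d t) (e t))) \<le> 6 * card I"
proof -
  have "card (\<Union>t\<in>I. insert (f t) (pentagon (a t) (b t) (c t) (d t) (e t)))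
      \<le> (\<Sum>t\<in>I. card (insert (f t) (pentagon (a t) (b t) (c t) (d t) (e t))))"
    using assms by (rule card_UN_le)
  also have "\<dots> \<le> (\<Sum>t\<in>I. 6)"
  proof (rule sum_mono)
    fix t
    have "card (insert (f t) (pentagon (a t) (b t) (c t) (d t) (e t)))
        \<le> Suc (card (pentagon (a t) (b t) (c t) (d t) (e t)))"
      by (rule card_insert_le_m1) auto
    then show "card (insert (f t) (pentagon (a t) (b t) (c t) (d t) (e t))) \<le> 6"
      using card_pentagon_le[of "a t" "b t" "c t" "d t" "e t"] by linarith
  qed
  finally show ?thesis by simp
qed

text \<open>The quadratic term is 2(k - 3) leaves with five vertices and k - 3 clique vertices. The
  linear term is six edges for each of at most 2(k - 3) visited leaves and 2(k - 3) terminal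
  levels.\<close>

lemma card_chords_H_graph:
  assumes k: "k \<ge> 4" and c: "is_cycle (H_graph k m) c"
  shows "card (chords (H_graph k m) c) \<le> ((k - 3) choose 2) + 10 * (k - 3)\<^sup>2 + 24 * (k - 3)"
proof -
  let ?p = "k - 3" and ?V = "visited k m c" and ?T = "terminal c"
  let ?Q = "{A. A \<subseteq> Clq ` {1..?p} \<and> card A = 2}"
  let ?J = "(\<lambda>(((x, i, j), l), h). {Leaf x i j l, Clq h}) ` ((?V \<times> UNIV) \<times> {1..?p})"
  let ?L = "\<Union>(x, i, j)\<in>?V. insert {Pent x i, Leaf x i j LR}
       (pentagon (Leaf x i j LR) (Leaf x i j LU) (Leaf x i j LV) (Leaf x i j LW) (Leaf x i j LZ))"
  let ?P = "\<Union>i\<in>?T. insert {Pent CC i, Pent CA (i + 1)}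
       (pentagon (Pent CA i) (Pent CB i) (Pent CC i) (Pent CD i) (Pent CT i))"
  have V: "card ?V \<le> 2 * ?p" using card_visited[OF k c] .
  have Q: "card ?Q = ?p choose 2"
    by (subst n_subsets) (auto simp: card_image inj_on_def)
  have fin: "finite ((?V \<times> (UNIV :: leaf_vert set)) \<times> {1..?p})"
    by (simp add: UNIV_leaf_vert)
  have "card ?J \<le> card ((?V \<times> (UNIV :: leaf_vert set)) \<times> {1..?p})"
    using fin by (rule card_image_le)
  also have "\<dots> = card ?V * 5 * ?p"
    by (simp add: card_cartesian_product UNIV_leaf_vert)
  also have "\<dots> \<le> 2 * ?p * 5 * ?p"
    using V by (intro mult_le_mono) auto
  finally have J: "card ?J \<le> 10 * ?p\<^sup>2"
    by (simp add: power2_eq_square)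
  have "card ?L \<le> 6 * card ?V"
    unfolding case_prod_unfold by (rule card_UN_insert_pentagon_le) simp
  then have L: "card ?L \<le> 12 * ?p" using V by simp
  have "card ?P \<le> 6 * card ?T"
    using terminal_bound(1)[OF k c] by (rule card_UN_insert_pentagon_le)
  then have P: "card ?P \<le> 12 * ?p" using terminal_bound(2)[OF k c] by simp
  have "finite (?Q \<union> ?J \<union> ?L \<union> ?P)"
    using fin terminal_bound(1)[OF k c] by (auto simp: pentagon_def)
  then have "card (chords (H_graph k m) c) \<le> card (?Q \<union> ?J \<union> ?L \<union> ?P)"
    using chords_subset[OF c] by (rule card_mono)
  also have "\<dots> \<le> card ?Q + card ?J + card ?L + card ?P"
    using card_Un_le[of "?Q \<union> ?J \<union> ?L" ?P] card_Un_le[of "?Q \<union> ?J" ?L] card_Un_le[of ?Q ?J]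
    by linarith
  finally show ?thesis using Q J L P by linarith
qed

section \<open>The infinite family\<close>

instance corner :: countable
  by countable_datatype

instance leaf_vert :: countable
  by countable_datatype

instance hvert :: countable
  by countable_datatype

text \<open>The number of vertices is affine in \<open>m\<close> with slope 25k - 80, which is
  positive for \<open>k \<ge> 4\<close>; hence it determines \<open>m\<close> and separates the
  isomorphism classes.\<close>

lemma H_graph_nat_family:
  assumes k: "k \<ge> 4"
  defines "\<H> \<equiv> \<lambda>m. map_graph (to_nat :: hvert \<Rightarrow> nat) (H_graph k m)"
  shows "infinite (\<H> ` {1..})" "pairwise (\<lambda>G G'. \<not> isomorphic G G') (\<H> ` {1..})"
proof -
  have card: "card (verts (\<H> m)) = card (verts (H_graph k m))" for m
    unfolding \<H>_def by (simp add: card_image)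
  have inj: "m = m'" if "card (verts (\<H> m)) = card (verts (\<H> m'))" for m m'
  proof -
    have "(25 * int k - 80) * int m = (25 * int k - 80) * int m'"
      using that card_H_graph_verts[OF k, of m] card_H_graph_verts[OF k, of m'] unfolding card by linarith
    then show ?thesis using k by simp
  qed
  then have "inj_on \<H> {1..}"
    by (metis inj_onI)
  then show "infinite (\<H> ` {1..})"
    by (simp add: finite_image_iff infinite_Ici)
  show "pairwise (\<lambda>G G'. \<not> isomorphic G G') (\<H> ` {1..})"
    unfolding pairwise_def using inj isomorphic_card by (metis imageE)
qed

theorem theorem1p6:
  "(\<exists>M :: nat \<Rightarrow> nat. \<forall>k\<ge>4. \<exists>\<G> :: nat sgraph set.
      infinite \<G> \<and> pairwise (\<lambda>G G'. \<not> isomorphic G G') \<G> \<and>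
      (\<forall>G\<in>\<G>. simple_graph G \<and> critical k G \<and>
         (\<forall>c. is_cycle G c \<longrightarrow> card (chords G c) \<le> M k))) \<and>
   (\<forall>k m. k \<ge> 4 \<longrightarrow> m \<ge> 1 \<longrightarrow>
      simple_graph (H_graph k m) \<and> critical k (H_graph k m) \<and>
      int (card (verts (H_graph k m))) = (25 * int k - 80) * int m + 26 * int k - 73 \<and>
      (\<forall>c. is_cycle (H_graph k m) c \<longrightarrow>
         card (chords (H_graph k m) c)
           \<le> ((k - 3) choose 2) + 10 * (k - 3)\<^sup>2 + 60 * (k - 3)))"
proof (intro conjI allI impI)
  let ?M = "\<lambda>k :: nat. ((k - 3) choose 2) + 10 * (k - 3)\<^sup>2 + 60 * (k - 3)"
  have bound: "card (chords (H_graph k m) c) \<le> ?M k" if "k \<ge> 4" "is_cycle (H_graph k m) c" for k m c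
    \<comment> \<open>The linear term 24(k - 3) of the count stays below the stated 60(k -
      3).\<close>
    using card_chords_H_graph[OF that] by linarith
  show "\<exists>M :: nat \<Rightarrow> nat. \<forall>k\<ge>4. \<exists>\<G> :: nat sgraph set.
      infinite \<G> \<and> pairwise (\<lambda>G G'. \<not> isomorphic G G') \<G> \<and>
      (\<forall>G\<in>\<G>. simple_graph G \<and> critical k G \<and>
         (\<forall>c. is_cycle G c \<longrightarrow> card (chords G c) \<le> M k))"
  proof (rule exI[of _ ?M], intro allI impI)
    fix k :: nat assume k: "4 \<le> k"
    let ?f = "to_nat :: hvert \<Rightarrow> nat"
    let ?G = "\<lambda>m. map_graph ?f (H_graph k m)"
    have "card (chords (?G m) c) \<le> ?M k" if c: "is_cycle (?G m) c" for m c
    proof -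
      obtain d where d: "c = map ?f d" "is_cycle (H_graph k m) d"
        using is_cycle_mapE[OF inj_to_nat c] .
      have "finite (chords (H_graph k m) d)"
      proof (rule finite_subset)
        show "chords (H_graph k m) d \<subseteq> Pow (set d)"
          unfolding chords_def by auto
      qed simp
      then have "card (chords (?G m) c) \<le> card (chords (H_graph k m) d)"
        unfolding d(1) chords_map[OF inj_to_nat] by (rule card_image_le)
      then show ?thesis using bound[OF k d(2)] by linarith
    qed
    then have "\<forall>G\<in>?G ` {1..}. simple_graph G \<and> critical k G \<and>
        (\<forall>c. is_cycle G c \<longrightarrow> card (chords G c) \<le> ?M k)"
      using simple_graph_map[OF inj_to_nat simple_H_graph]
        critical_map[OF inj_to_nat critical_H_graph[OF k]] by blast
    then show "\<exists>\<G> :: nat sgraph set.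
      infinite \<G> \<and> pairwise (\<lambda>G G'. \<not> isomorphic G G') \<G> \<and>
      (\<forall>G\<in>\<G>. simple_graph G \<and> critical k G \<and>
         (\<forall>c. is_cycle G c \<longrightarrow> card (chords G c) \<le> ?M k))"
      using H_graph_nat_family[OF k] by blast
  qed
  fix k m :: nat assume k: "4 \<le> k"
  show "simple_graph (H_graph k m)" by (rule simple_H_graph)
  show "critical k (H_graph k m)" using critical_H_graph[OF k] .
  show "int (card (verts (H_graph k m))) = (25 * int k - 80) * int m + 26 * int k - 73"
    using card_H_graph_verts[OF k] .
  fix c assume "is_cycle (H_graph k m) c"
  then show "card (chords (H_graph k m) c) \<le> ?M k" using bound[OF k] by blast
qed

end
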